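(* Let $\lambda>0$, let $u_0\in H^s$ with $s>\frac32$, and let $T$ be the maximal existence time of the solution $u$ to the weakly dissipative $\mu$HS equation with initial data $u_0$. If $u_0$ is odd and satisfies $u_0'(0)<-2\lambda$, then the corresponding solution blows up in finite time.
   Context: $\mathbb S=\mathbb R/\mathbb Z$; functions on $\mathbb S$ are identified with 1-periodic functions on $\mathbb R$; $H^s=H^s(\mathbb S)$ (real-valued). $\mu(w)=\int_{\mathbb S}w\,dx$, $\mu_0:=\mu(u_0)$, and $A=\mu-\partial_x^2$ (i.e. $Aw=\mu(w)-w_{xx}$), an isomorphism $H^s\to H^{s-2}$. The weakly dissipative $\mu$HS equation is $y_t+uy_x+2u_xy+\lambda y=0$ for $t>0$, $x\in\mathbb R$, with $y=\mu(u)-u_{xx}$, $u(0,x)=u_0(x)$, $u(t,x+1)=u(t,x)$; equivalently $$u_t+uu_x=-\partial_xA^{-1}\left(2\mu_0e^{-\lambda t}u+\tfrac12u_x^2\right)-\lambda u,\qquad u(0,\cdot)=u_0 .$$ For $u_0\in H^s$, $s>\frac32$, there is a unique solution $u\in C([0,T);H^s)\cap C^1([0,T);H^{s-1})$ of this nonlocal form (as an equation in $H^{s-1}$), where $T=T(u_0)\in(0,\infty]$ is the maximal existence time. "Blows up in finite time" means $T<\infty$. *)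

theory Defs
  imports "HOL-Analysis.Analysis"
begin

text \<open>
  Functions on the circle are 1-periodic functions of type \<^typ>\<open>real \<Rightarrow> real\<close>.
\<close>

definition mean :: "(real \<Rightarrow> real) \<Rightarrow> real" where
  "mean w = (LBINT x:{0..1}. w x)"

definition fourier_coeff :: "(real \<Rightarrow> real) \<Rightarrow> int \<Rightarrow> complex" where
  "fourier_coeff f n =
     (LBINT x:{0..1}. complex_of_real (f x) * exp (- (2 * pi * of_int n * x) * \<i>))"

text \<open>
  An element of \<open>H\<^sup>s\<close> is a class of functions modulo equality almost everywhere.  For \<open>s > 1/2\<close>
  every class has exactly one continuous representative, and \<open>sobolev s\<close> is the set of these
  representatives; the definition is meant for \<open>s > 1/2\<close> only.  Below, with \<open>s > 3/2\<close>,
  the exponents \<open>s\<close>, \<open>s - 1\<close> and \<open>s + 1\<close> are used.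
\<close>

definition sobolev :: "real \<Rightarrow> (real \<Rightarrow> real) set" where
  "sobolev s = {f. (\<forall>x. f (x + 1) = f x) \<and> continuous_on UNIV f \<and>
     (\<lambda>n::int. (1 + (of_int n)\<^sup>2) powr s * (cmod (fourier_coeff f n))\<^sup>2) summable_on UNIV}"

definition sobolev_norm :: "real \<Rightarrow> (real \<Rightarrow> real) \<Rightarrow> real" where
  "sobolev_norm s f =
     sqrt (\<Sum>\<^sub>\<infinity>n::int. (1 + (of_int n)\<^sup>2) powr s * (cmod (fourier_coeff f n))\<^sup>2)"

definition opA :: "(real \<Rightarrow> real) \<Rightarrow> real \<Rightarrow> real" where
  "opA w = (\<lambda>x. mean w - deriv (deriv w) x)"

text \<open>
  The inverse of the isomorphism \<open>opA\<close> from \<open>H\<^bsup>r+2\<^esup>\<close> onto \<open>H\<^sup>r\<close>.  For \<open>r > 1/2\<close> the space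
  \<open>H\<^bsup>r+2\<^esup>\<close> consists of \<open>C\<^sup>2\<close> functions, so the pointwise derivatives in \<open>opA\<close> are the right ones.
\<close>

definition opA_inv :: "real \<Rightarrow> (real \<Rightarrow> real) \<Rightarrow> real \<Rightarrow> real" where
  "opA_inv r = the_inv_into (sobolev (r + 2)) opA"

definition time_interval :: "ereal \<Rightarrow> real set" where
  "time_interval T = {t. 0 \<le> t \<and> ereal t < T}"

definition continuous_in_sobolev :: "real \<Rightarrow> real set \<Rightarrow> (real \<Rightarrow> real \<Rightarrow> real) \<Rightarrow> bool" where
  "continuous_in_sobolev s I u \<longleftrightarrow>
     (\<forall>t\<in>I. u t \<in> sobolev s) \<and>
     (\<forall>t\<in>I. ((\<lambda>\<tau>. sobolev_norm s (\<lambda>x. u \<tau> x - u t x)) \<longlongrightarrow> 0) (at t within I))"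

text \<open>\<open>v\<close> is the derivative in time of \<open>u\<close>, taken in the norm of \<open>H\<^sup>s\<close> (one-sided at endpoints
  of \<open>I\<close>).\<close>

definition C1_in_sobolev ::
  "real \<Rightarrow> real set \<Rightarrow> (real \<Rightarrow> real \<Rightarrow> real) \<Rightarrow> (real \<Rightarrow> real \<Rightarrow> real) \<Rightarrow> bool" where
  "C1_in_sobolev s I u v \<longleftrightarrow>
     continuous_in_sobolev s I u \<and> continuous_in_sobolev s I v \<and>
     (\<forall>t\<in>I. ((\<lambda>\<tau>. sobolev_norm s (\<lambda>x. (u \<tau> x - u t x) / (\<tau> - t) - v t x)) \<longlongrightarrow> 0)
              (at t within I))"

text \<open>
  Solution on \<open>[0,T)\<close> of the nonlocal form.  The equation is one between elements of
  \<open>H\<^bsup>s-1\<^esup>\<close>; both sides are continuous functions, hence the pointwise equality.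
\<close>

definition muHS_solution ::
  "real \<Rightarrow> real \<Rightarrow> (real \<Rightarrow> real) \<Rightarrow> ereal \<Rightarrow> (real \<Rightarrow> real \<Rightarrow> real) \<Rightarrow> bool" where
  "muHS_solution lam s u0 T u \<longleftrightarrow>
     0 < T \<and>
     continuous_in_sobolev s (time_interval T) u \<and>
     (\<exists>ut. C1_in_sobolev (s - 1) (time_interval T) u ut \<and>
        (\<forall>t\<in>time_interval T. \<forall>x.
           ut t x + u t x * deriv (u t) x =
             - deriv (opA_inv (s - 1)
                 (\<lambda>z. 2 * mean u0 * exp (- lam * t) * u t z + 1/2 * (deriv (u t) z)\<^sup>2)) x
             - lam * u t x)) \<and>
     u 0 = u0"

definition maximal_muHS_solution ::
  "real \<Rightarrow> real \<Rightarrow> (real \<Rightarrow> real) \<Rightarrow> ereal \<Rightarrow> (real \<Rightarrow> real \<Rightarrow> real) \<Rightarrow> bool" where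
  "maximal_muHS_solution lam s u0 T u \<longleftrightarrow>
     muHS_solution lam s u0 T u \<and> (\<forall>T' v. muHS_solution lam s u0 T' v \<longrightarrow> T' \<le> T)"

end

theory Submission
  imports Defs
begin

text \<open>
  Why a solution cannot be global.  Suppose \<open>u\<close> is defined for all times.  Since \<open>u0\<close> is odd, its mean
  vanishes, so the source of the nonlocal term is just half the square of the slope \<open>u\<^sub>x\<close>.  As
  \<open>w = A\<inverse> f\<close> satisfies \<open>w'' = mean f - f\<close>, differentiating the equation formally along a
  characteristic gives, for the slope \<open>m\<close> on it,
  \<open>m' = - m\<^sup>2 / 2 - lam * m - mean (u\<^sub>x\<^sup>2) / 2 \<le> - m * (m + 2 * lam) / 2\<close>.
  A slope that starts below \<open>- 2 * lam\<close> is thus driven to \<open>- \<infinity>\<close> in finite time, whereas a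
  solution that is continuous in \<open>H\<^sup>s\<close> with \<open>s > 3/2\<close> has a slope bounded on compact time intervals.

  The oddness of \<open>u0\<close> enters through its mean, and \<open>u0'(0)\<close> as one point at which the slope is steep.
  The differentiation is justified by replacing the slope by a difference quotient with a fixed small step,
  and the characteristic by the minimum points of this quotient; theorem
  \<open>classical_slope_blowup\<close> carries this out for classical solutions.

  What remains is to see that \<open>u\<close> is such a classical solution, and this is Fourier analysis on the
  circle.  Continuous functions are determined by their Fourier coefficients
  (\<open>circle_fun_eqI_fourier_coeff\<close>).  Consequently \<open>H\<^sup>r\<close> with \<open>r > 1/2\<close> embeds into the bounded
  functions (\<open>sobolev_embedding\<close>), functions in \<open>H\<^sup>s\<close> with \<open>s > 3/2\<close> are continuously differentiable
  with derivative in \<open>H\<^bsup>s-1\<^esup>\<close> (\<open>sobolev_differentiable\<close>), \<open>H\<^sup>r\<close> is closed under squaring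
  (\<open>sobolev_square\<close>), and \<open>opA_inv\<close> solves the expected second-order equation
  (\<open>opA_inv_second_derivative\<close>).
\<close>

section \<open>Fourier coefficients determine a continuous periodic function\<close>

definition wave :: "int \<Rightarrow> real \<Rightarrow> complex" where
  "wave n x = cis (2 * pi * of_int n * x)"

lemma wave_0 [simp]: "wave 0 x = 1"
  by (simp add: wave_def)

lemma wave_at_0 [simp]: "wave n 0 = 1"
  by (simp add: wave_def)

lemma norm_wave [simp]: "cmod (wave n x) = 1"
  by (simp add: wave_def)

lemma wave_mult: "wave m x * wave n x = wave (m + n) x"
  by (simp add: wave_def cis_mult algebra_simps)

lemma cnj_wave: "cnj (wave n x) = wave (- n) x"
  by (simp add: wave_def cis_cnj)

lemma wave_periodic [simp]: "wave n (x + 1) = wave n x"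
proof -
  have "wave n (x + 1) = wave n x * cis (2 * pi * of_int n)"
    by (simp add: wave_def cis_mult algebra_simps)
  then show ?thesis
    by (simp add: cis_multiple_2pi)
qed

lemma continuous_on_wave [continuous_intros]: "continuous_on S (wave n)"
  unfolding wave_def by (intro continuous_intros)

lemma wave_has_vector_derivative:
  "(wave n has_vector_derivative (2 * pi * of_int n * \<i>) * wave n x) (at x within S)"
proof -
  show ?thesis
    unfolding wave_def has_vector_derivative_def
    by (auto intro!: derivative_eq_intros simp: scaleR_conv_of_real algebra_simps)
qed

definition circle_fun :: "(real \<Rightarrow> real) \<Rightarrow> bool" where
  "circle_fun f \<longleftrightarrow> (\<forall>x. f (x + 1) = f x) \<and> continuous_on UNIV f"

lemma circle_funD:
  assumes "circle_fun f"
  shows "f (x + 1) = f x" "continuous_on S f"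
  using assms by (auto simp: circle_fun_def intro: continuous_on_subset)

lemma mean_eq_integral:
  assumes "circle_fun f"
  shows "mean f = integral {0..1} f"
  unfolding mean_def
  by (intro set_borel_integral_eq_integral(2) borel_integrable_atLeastAtMost' circle_funD assms)

lemma fourier_coeff_eq_integral:
  assumes "circle_fun f"
  shows "fourier_coeff f n = integral {0..1} (\<lambda>x. of_real (f x) * wave (- n) x)"
proof -
  have "fourier_coeff f n = (LBINT x:{0..1}. of_real (f x) * wave (- n) x)"
    unfolding fourier_coeff_def wave_def cis_conv_exp by (simp add: algebra_simps)
  also have "\<dots> = integral {0..1} (\<lambda>x. of_real (f x) * wave (- n) x)"
    by (intro set_borel_integral_eq_integral(2) borel_integrable_atLeastAtMost'
        continuous_intros circle_funD assms)
  finally show ?thesis .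
qed

lemma circle_fun_int_shift:
  assumes "circle_fun f"
  shows "f (x + of_int n) = f x"
proof (induction n)
  case (nonneg n)
  show ?case
  proof (induction n)
    case (Suc n)
    then show ?case
      using circle_funD(1)[OF assms, of "x + real n"] by (simp add: ac_simps)
  qed simp
next
  case (neg n)
  show ?case
  proof (induction n)
    case 0
    then show ?case
      using circle_funD(1)[OF assms, of "x - 1"] by simp
  next
    case (Suc n)
    then show ?case
      using circle_funD(1)[OF assms, of "x - 2 - real n"] by (simp add: algebra_simps)
  qed
qed

lemma circle_fun_frac:
  assumes "circle_fun f"
  shows "f (frac x) = f x"
  using circle_fun_int_shift[OF assms, of x "- \<lfloor>x\<rfloor>"] by (simp add: frac_def)

lemma circle_fun_bounded:
  assumes "circle_fun f"
  obtains M where "\<And>x. \<bar>f x\<bar> \<le> M"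
proof -
  have "compact (f ` {0..1})"
    by (intro compact_continuous_image circle_funD assms) auto
  then obtain M where M: "\<And>x. x \<in> {0..1} \<Longrightarrow> \<bar>f x\<bar> \<le> M"
    by (metis bounded_iff compact_imp_bounded image_eqI real_norm_def)
  have "\<bar>f x\<bar> \<le> M" for x
  proof -
    have "frac x \<in> {0..1}"
      using frac_lt_1[of x] by (auto intro: less_imp_le)
    from M[OF this] show ?thesis
      using circle_fun_frac[OF assms, of x] by simp
  qed
  with that show ?thesis by blast
qed

lemma circle_fun_linear:
  assumes "circle_fun f" "circle_fun g"
  shows "circle_fun (\<lambda>x. a * f x + b * g x)"
  using assms by (auto simp: circle_fun_def intro!: continuous_intros)

lemma fourier_coeff_linear:
  assumes "circle_fun f" "circle_fun g"
  shows "fourier_coeff (\<lambda>x. a * f x + b * g x) n = a * fourier_coeff f n + b * fourier_coeff g n"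
proof -
  have int: "(\<lambda>x. of_real (h x) * wave (- n) x) integrable_on {0..1}" if "circle_fun h" for h
    by (intro integrable_continuous_interval continuous_intros circle_funD that)
  have "fourier_coeff (\<lambda>x. a * f x + b * g x) n =
          integral {0..1} (\<lambda>x. of_real a * (of_real (f x) * wave (- n) x) +
                               of_real b * (of_real (g x) * wave (- n) x))"
    by (subst fourier_coeff_eq_integral)
       (simp_all add: circle_fun_linear assms algebra_simps)
  also have "\<dots> = a * fourier_coeff f n + b * fourier_coeff g n"
    using assms by (subst integral_add) (auto intro!: integrable_on_mult_right int
        simp: integral_mult_right fourier_coeff_eq_integral)
  finally show ?thesis .
qed

lemma fourier_coeff_diff:
  assumes "circle_fun f" "circle_fun g"
  shows "fourier_coeff (\<lambda>x. f x - g x) n = fourier_coeff f n - fourier_coeff g n"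
  using fourier_coeff_linear[OF assms, of 1 "-1" n] by simp

lemma integral_wave: "integral {0..1} (wave n) = (if n = 0 then 1 else 0)"
proof (cases "n = 0")
  case False
  have "((\<lambda>x. (2 * pi * of_int n * \<i>) * wave n x) has_integral (wave n 1 - wave n 0)) {0..1}"
    by (intro fundamental_theorem_of_calculus wave_has_vector_derivative) auto
  moreover have "wave n 1 = 1"
    using wave_periodic[of n 0] by simp
  ultimately have "((\<lambda>x. (2 * pi * of_int n * \<i>) * wave n x) has_integral 0) {0..1}"
    by simp
  then have "integral {0..1} (\<lambda>x. (2 * pi * of_int n * \<i>) * wave n x) = 0"
    by (rule integral_unique)
  then have "(2 * pi * of_int n * \<i>) * integral {0..1} (wave n) = 0"
    by (subst (asm) integral_mult_right)
  with False show ?thesis by simp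
next
  case True
  then have "wave n = (\<lambda>x. 1)" by auto
  with True show ?thesis by simp
qed

text \<open>
  The bump \<open>Q\<close> is a trigonometric polynomial, so every power of it is one too, and a function with
  vanishing Fourier coefficients is orthogonal to all of them.  The induction carries a factor
  \<open>wave m\<close> along because multiplying by \<open>Q\<close> shifts the frequency by \<open>1\<close> and \<open>- 1\<close>.
\<close>
lemma zero_coeffs_orthogonal_bump_powers:
  fixes f :: "real \<Rightarrow> real" and x0 :: real and k :: nat
  assumes f: "circle_fun f" and zero: "\<And>n. fourier_coeff f n = 0"
  defines "Q \<equiv> \<lambda>x. (1 + cos (2 * pi * (x - x0))) / 2"
  shows "integral {0..1} (\<lambda>x. f x * Q x ^ k) = 0"
proof -
  have contQ: "continuous_on {0..1} Q"
    unfolding Q_def by (intro continuous_intros) auto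
  have Q_wave: "complex_of_real (Q x) = 1/2 + (wave (-1) x0 / 4) * wave 1 x + (wave 1 x0 / 4) * wave (-1) x" for x
    unfolding Q_def wave_def
    by (simp add: complex_eq_iff cos_diff sin_diff algebra_simps add_divide_distrib diff_divide_distrib)
  have "integral {0..1} (\<lambda>x. of_real (f x * Q x ^ k) * wave m x) = 0" for m
  proof (induction k arbitrary: m)
    case 0
    show ?case using zero[of "- m"] fourier_coeff_eq_integral[OF f, of "- m"] by simp
  next
    case (Suc k)
    let ?g = "\<lambda>m x. of_real (f x * Q x ^ k) * wave m x"
    have int: "?g m integrable_on {0..1}" for m
      by (intro integrable_continuous_interval continuous_intros circle_funD f contQ)
    have "of_real (f x * Q x ^ Suc k) * wave m x =
            (1/2) * ?g m x + ((wave (-1) x0 / 4) * ?g (m + 1) x + (wave 1 x0 / 4) * ?g (m - 1) x)" for x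
    proof -
      have "of_real (f x * Q x ^ Suc k) * wave m x = of_real (f x * Q x ^ k) * (of_real (Q x) * wave m x)"
        by simp
      also have "of_real (Q x) * wave m x =
          (1/2) * wave m x + (wave (-1) x0 / 4) * (wave m x * wave 1 x) + (wave 1 x0 / 4) * (wave m x * wave (-1) x)"
        by (simp add: Q_wave algebra_simps)
      also have "\<dots> = (1/2) * wave m x + (wave (-1) x0 / 4) * wave (m + 1) x + (wave 1 x0 / 4) * wave (m - 1) x"
        unfolding wave_mult by simp
      finally show ?thesis by (simp add: algebra_simps)
    qed
    then have "integral {0..1} (\<lambda>x. of_real (f x * Q x ^ Suc k) * wave m x) =
      integral {0..1} (\<lambda>x. (1/2) * ?g m x + ((wave (-1) x0 / 4) * ?g (m + 1) x + (wave 1 x0 / 4) * ?g (m - 1) x))"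
      by presburger
    also have "\<dots> = (1/2) * integral {0..1} (?g m) + ((wave (-1) x0 / 4) * integral {0..1} (?g (m + 1)) + (wave 1 x0 / 4) * integral {0..1} (?g (m - 1)))"
      by (subst integral_add | intro integrable_add integrable_on_mult_right int | subst integral_mult_right)+ simp
    also have "\<dots> = 0"
      using Suc.IH by simp
    finally show ?case .
  qed
  from this[of 0] have "integral {0..1} (\<lambda>x. complex_of_real (f x * Q x ^ k)) = 0"
    by simp
  moreover have "((\<lambda>x. complex_of_real (f x * Q x ^ k)) has_integral of_real (integral {0..1} (\<lambda>x. f x * Q x ^ k))) {0..1}"
    by (intro has_integral_of_real integrable_integral integrable_continuous_interval
        continuous_intros circle_funD f contQ)
  ultimately show ?thesis
    by (simp add: integral_unique)
qed

text \<open>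
  Concentration argument.  The bump \<open>Q\<close> equals \<open>1\<close> exactly at \<open>x0\<close> modulo \<open>1\<close>.  If \<open>f x0 > 0\<close>, then
  \<open>Q\<close> is at most some \<open>th < 1\<close> on the compact set \<open>K\<close> where \<open>f \<le> c = f x0 / 2\<close>, whereas
  \<open>Q\<close> exceeds \<open>th' > th\<close> near \<open>x0\<close>, where \<open>f > c\<close>.  For large \<open>k\<close> the mass near \<open>x0\<close> dominates in
  the integral of \<open>f x * Q x ^ k\<close>, which vanishes by orthogonality.
\<close>
lemma zero_coeffs_imp_nonpos:
  assumes f: "circle_fun f" and zero: "\<And>n. fourier_coeff f n = 0" and x0: "0 < x0" "x0 < 1"
  shows "f x0 \<le> 0"
proof (rule ccontr)
  assume "\<not> f x0 \<le> 0"
  then have pos: "f x0 > 0" by simp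
  define c where "c = f x0 / 2"
  have c: "c > 0" "c < f x0" using pos by (auto simp: c_def)
  define Q where "Q = (\<lambda>x. (1 + cos (2 * pi * (x - x0))) / 2)"
  have contQ: "continuous_on S Q" for S
    unfolding Q_def by (intro continuous_intros) auto
  have Q_le_1: "Q x \<le> 1" and Q_ge_0: "Q x \<ge> 0" for x
  proof -
    obtain y where y: "y = cos (2 * pi * (x - x0))" by blast
    have "- 1 \<le> y" "y \<le> 1" unfolding y by (rule cos_ge_minus_one, rule cos_le_one)
    then show "Q x \<le> 1" "Q x \<ge> 0" unfolding Q_def y [symmetric] by auto
  qed
  define K where "K = {x \<in> {0..1}. f x \<le> c}"
  have "compact K"
  proof -
    have "closed {x. f x \<le> c}"
      by (intro closed_Collect_le continuous_intros circle_funD f)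
    moreover have "K = {0..1} \<inter> {x. f x \<le> c}" unfolding K_def by auto
    ultimately show ?thesis by (simp add: compact_Int_closed)
  qed
  have Q_lt_1: "Q x < 1" if "x \<in> K" for x
  proof (rule ccontr)
    assume "\<not> Q x < 1"
    then have "cos (2 * pi * (x - x0)) = 1"
      using cos_le_one[of "2 * pi * (x - x0)"] by (simp only: Q_def) argo
    then obtain n :: int where "2 * pi * (x - x0) = of_int n * 2 * pi"
      by (auto simp: cos_one_2pi_int)
    then have "(2 * pi) * (x - x0) = (2 * pi) * of_int n" by (simp only: mult_ac)
    then have "x - x0 = of_int n" by (subst (asm) mult_left_cancel) auto
    then have "x = x0 + of_int n" by simp
    then have "f x = f x0" using circle_fun_int_shift[OF f] by simp
    with that c show False by (simp add: K_def)
  qed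
  obtain th where th: "0 < th" "th < 1" "\<And>x. x \<in> K \<Longrightarrow> Q x \<le> th"
  proof (cases "K = {}")
    case True
    then show ?thesis using that[of "1/2"] by auto
  next
    case False
    then obtain y where y: "y \<in> K" "\<And>x. x \<in> K \<Longrightarrow> Q x \<le> Q y"
      using continuous_attains_sup[OF \<open>compact K\<close> False contQ] by blast
    show ?thesis
      using that[of "max (1/2) (Q y)"] y Q_lt_1[OF y(1)] by force
  qed
  \<comment> \<open>Any value strictly between \<open>th\<close> and \<open>Q x0 = 1\<close>.\<close>
  define th' where "th' = (1 + th) / 2"
  have th': "th < th'" "th' < 1" "0 < th'" using th by (auto simp: th'_def)
  have "open {x. f x > c \<and> Q x > th' \<and> 0 < x \<and> x < 1}"
    by (intro open_Collect_conj open_Collect_less continuous_intros contQ circle_funD f)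
  moreover have "x0 \<in> {x. f x > c \<and> Q x > th' \<and> 0 < x \<and> x < 1}"
    using c th' x0 by (auto simp: Q_def)
  ultimately obtain d where d: "d > 0" "cball x0 d \<subseteq> {x. f x > c \<and> Q x > th' \<and> 0 < x \<and> x < 1}"
    by (meson open_contains_cball)
  have J: "f x > c" "Q x > th'" "x \<in> {0..1}" if "x \<in> {x0 - d..x0 + d}" for x
  proof -
    have "x \<in> cball x0 d" using that by (auto simp: dist_real_def)
    with d(2) show "f x > c" "Q x > th'" "x \<in> {0..1}" by auto
  qed
  obtain M where M: "\<And>x. \<bar>f x\<bar> \<le> M" using circle_fun_bounded[OF f] by blast
  have M0: "M \<ge> 0" using M[of 0] by linarith
  have key: "2 * d * (c * th' ^ k) \<le> M * th ^ k" for k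
  proof -
    have I1: "((\<lambda>x. if x \<in> {x0 - d..x0 + d} then c * th' ^ k else 0) has_integral (2 * d * (c * th' ^ k))) {0..1}"
    proof -
      have "((\<lambda>x. c * th' ^ k) has_integral (2 * d * (c * th' ^ k))) {x0 - d..x0 + d}"
        using has_integral_const_real[of "c * th' ^ k" "x0 - d" "x0 + d"] d(1) by simp
      moreover have "{x0 - d..x0 + d} \<subseteq> {0..1}" using J(3) by blast
      ultimately show ?thesis by (simp only: has_integral_restrict)
    qed
    have I2: "((\<lambda>x::real. M * th ^ k) has_integral (M * th ^ k)) {0..1}"
      using has_integral_const_real[of "M * th ^ k" 0 1] by simp
    have I3: "((\<lambda>x. f x * Q x ^ k) has_integral 0) {0..1}"
    proof -
      have "(\<lambda>x. f x * Q x ^ k) integrable_on {0..1}"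
        by (intro integrable_continuous_interval continuous_intros circle_funD f contQ)
      then show ?thesis
        using zero_coeffs_orthogonal_bump_powers[OF f zero, of x0 k]
        unfolding Q_def by (metis integrable_integral)
    qed
    have "2 * d * (c * th' ^ k) \<le> 0 + M * th ^ k"
    proof (rule has_integral_le[OF I1 has_integral_add[OF I3 I2]])
      fix x :: real assume x: "x \<in> {0..1}"
      have Mk: "0 \<le> M * th ^ k" using M0 th by simp
      consider "x \<in> {x0 - d..x0 + d}" | "x \<notin> {x0 - d..x0 + d}" "x \<in> K" | "x \<notin> {x0 - d..x0 + d}" "f x > c"
        using x unfolding K_def by fastforce
      then show "(if x \<in> {x0 - d..x0 + d} then c * th' ^ k else 0) \<le> f x * Q x ^ k + M * th ^ k"
      proof cases
        case 1
        have "c * th' ^ k \<le> f x * Q x ^ k"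
          using J[OF 1] c th' by (intro mult_mono power_mono) auto
        with 1 Mk show ?thesis by simp
      next
        case 2
        have "\<bar>f x * Q x ^ k\<bar> \<le> M * th ^ k"
          unfolding abs_mult using M[of x] M0 th(3)[OF 2(2)] Q_ge_0[of x]
          by (intro mult_mono) (auto simp: power_abs intro!: power_mono)
        with 2 show ?thesis by auto
      next
        case 3
        then have "0 \<le> f x * Q x ^ k" using c Q_ge_0[of x] by simp
        with 3 Mk show ?thesis by auto
      qed
    qed
    then show ?thesis by simp
  qed
  have "(\<lambda>k. M * (th / th') ^ k) \<longlonglongrightarrow> M * 0"
    using th th' by (intro tendsto_mult tendsto_const LIMSEQ_realpow_zero) auto
  moreover have "2 * d * c \<le> M * (th / th') ^ k" for k
    using key[of k] th' by (simp add: power_divide field_simps)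
  ultimately have "2 * d * c \<le> M * 0"
    by (meson LIMSEQ_le_const)
  with d(1) c(1) show False
    by (simp add: mult_le_0_iff)
qed

text \<open>
  The concentration argument applies to both \<open>f - g\<close> and \<open>g - f\<close> at interior points of the period;
  continuity gives the endpoints.
\<close>
theorem circle_fun_eqI_fourier_coeff:
  assumes f: "circle_fun f" and g: "circle_fun g"
    and eq: "\<And>n. fourier_coeff f n = fourier_coeff g n"
  shows "f = g"
proof -
  define h where "h = (\<lambda>x. f x - g x)"
  have "circle_fun (\<lambda>x. f x - g x)" "circle_fun (\<lambda>x. g x - f x)"
    using circle_fun_linear[OF f g, of 1 "-1"] circle_fun_linear[OF g f, of 1 "-1"] by simp_all
  then have open_eq: "f x = g x" if "0 < x" "x < 1" for x
    using zero_coeffs_imp_nonpos[of "\<lambda>x. f x - g x" x] zero_coeffs_imp_nonpos[of "\<lambda>x. g x - f x" x]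
    by (force simp: that eq fourier_coeff_diff f g)
  have conth: "continuous_on S h" for S
    unfolding h_def by (intro continuous_intros circle_funD f g)
  have "h x = 0" if "x \<in> closure {0<..<1}" for x
    using continuous_constant_on_closure[OF conth, of "{0<..<1}" 0 x] that open_eq
    by (auto simp: h_def)
  then have cl: "f x = g x" if "x \<in> {0..1}" for x :: real
    using that by (simp add: h_def)
  show "f = g"
  proof
    fix x :: real
    have "frac x \<in> {0..1}" using frac_lt_1[of x] by (auto intro: less_imp_le)
    from cl[OF this] show "f x = g x"
      by (simp add: circle_fun_frac f g)
  qed
qed

section \<open>Fourier series of Sobolev functions\<close>

lemma infsum_Cauchy_Schwarz:
  fixes p q :: "'a \<Rightarrow> real"
  assumes p: "(\<lambda>n. (p n)\<^sup>2) summable_on UNIV" and q: "(\<lambda>n. (q n)\<^sup>2) summable_on UNIV"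
    and nonneg: "\<And>n. p n \<ge> 0" "\<And>n. q n \<ge> 0"
  shows "(\<lambda>n. p n * q n) summable_on UNIV"
    and "(\<Sum>\<^sub>\<infinity>n. p n * q n) \<le> sqrt (\<Sum>\<^sub>\<infinity>n. (p n)\<^sup>2) * sqrt (\<Sum>\<^sub>\<infinity>n. (q n)\<^sup>2)"
proof -
  have bound: "(\<Sum>n\<in>F. p n * q n) \<le> sqrt (\<Sum>\<^sub>\<infinity>n. (p n)\<^sup>2) * sqrt (\<Sum>\<^sub>\<infinity>n. (q n)\<^sup>2)" if "finite F" for F
  proof -
    have "(\<Sum>n\<in>F. p n * q n) = (\<Sum>n\<in>F. \<bar>p n\<bar> * \<bar>q n\<bar>)"
      using nonneg by simp
    also have "\<dots> \<le> L2_set p F * L2_set q F"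
      by (rule L2_set_mult_ineq)
    also have "\<dots> \<le> sqrt (\<Sum>\<^sub>\<infinity>n. (p n)\<^sup>2) * sqrt (\<Sum>\<^sub>\<infinity>n. (q n)\<^sup>2)"
      unfolding L2_set_def
      by (intro mult_mono real_sqrt_le_mono finite_sum_le_infsum p q that)
         (auto intro: sum_nonneg infsum_nonneg)
    finally show ?thesis .
  qed
  show "(\<lambda>n. p n * q n) summable_on UNIV"
  proof (rule nonneg_bdd_above_summable_on)
    show "bdd_above (sum (\<lambda>n. p n * q n) ` {F. F \<subseteq> UNIV \<and> finite F})"
      using bound by (auto intro!: bdd_aboveI)
  qed (use nonneg in auto)
  then show "(\<Sum>\<^sub>\<infinity>n. p n * q n) \<le> sqrt (\<Sum>\<^sub>\<infinity>n. (p n)\<^sup>2) * sqrt (\<Sum>\<^sub>\<infinity>n. (q n)\<^sup>2)"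
    by (rule infsum_le_finite_sums) (use bound in auto)
qed

lemma summable_on_int_weight:
  assumes "r > 1/2"
  shows "(\<lambda>n::int. (1 + (of_int n)\<^sup>2) powr (- r) :: real) summable_on UNIV"
proof -
  define w where "w = (\<lambda>n::int. (1 + (of_int n)\<^sup>2) powr (- r) :: real)"
  have "summable (\<lambda>n::nat. real n powr (- 2 * r))"
    using assms by (simp add: summable_real_powr_iff)
  then have "(\<lambda>n::nat. real n powr (- 2 * r)) summable_on UNIV"
    by (intro summable_nonneg_imp_summable_on) auto
  moreover have "(\<lambda>n::nat. if n = 0 then 1 else 0 :: real) summable_on UNIV"
    by (rule finite_nonzero_values_imp_summable_on) simp
  ultimately have "(\<lambda>n::nat. real n powr (- 2 * r) + (if n = 0 then 1 else 0)) summable_on UNIV"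
    by (rule summable_on_add)
  then have nat: "(\<lambda>n::nat. w (int n)) summable_on UNIV"
  proof (rule summable_on_comparison_test)
    fix n :: nat
    show "w (int n) \<le> real n powr (- 2 * r) + (if n = 0 then 1 else 0)"
    proof (cases "n = 0")
      case False
      have "(1 + (real n)\<^sup>2) powr (- r) \<le> ((real n)\<^sup>2) powr (- r)"
        using False assms by (intro powr_mono2') auto
      also have "\<dots> = real n powr (- 2 * r)"
        using False powr_powr[of "real n" 2 "- r"] by simp
      finally show ?thesis using False by (simp add: w_def)
    qed (simp add: w_def)
  qed (simp add: w_def)
  have "w summable_on range int"
    by (subst summable_on_reindex) (use nat in \<open>auto simp: o_def\<close>)
  moreover have "w summable_on range (\<lambda>n. - int n)"
    by (subst summable_on_reindex) (use nat in \<open>auto simp: o_def w_def inj_on_def\<close>)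
  ultimately have "w summable_on (range int \<union> range (\<lambda>n. - int n))"
    by (rule summable_on_union)
  also have "range int \<union> range (\<lambda>n. - int n) = UNIV"
  proof -
    have "n \<in> range int \<union> range (\<lambda>n. - int n)" for n
      by (cases n rule: int_cases2) auto
    then show ?thesis by auto
  qed
  finally show ?thesis by (simp add: w_def)
qed

lemma sobolevD:
  assumes "f \<in> sobolev r"
  shows "circle_fun f"
    and "(\<lambda>n::int. (1 + (of_int n)\<^sup>2) powr r * (cmod (fourier_coeff f n))\<^sup>2) summable_on UNIV"
  using assms by (auto simp: sobolev_def circle_fun_def)

lemma sobolevI:
  assumes "circle_fun f"
    and "(\<lambda>n::int. (1 + (of_int n)\<^sup>2) powr r * (cmod (fourier_coeff f n))\<^sup>2) summable_on UNIV"
  shows "f \<in> sobolev r"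
  using assms by (auto simp: sobolev_def circle_fun_def)

lemma sobolev_norm_nonneg: "sobolev_norm r f \<ge> 0"
  unfolding sobolev_norm_def by (auto intro: infsum_nonneg)

text \<open>
  Cauchy-Schwarz, after writing the modulus of \<open>a n\<close> as \<open>w powr (- r / 2)\<close> times
  \<open>w powr (r / 2) * cmod (a n)\<close> with the weight \<open>w = 1 + n\<^sup>2\<close>; the first factor is square summable
  exactly when \<open>r > 1/2\<close>.
\<close>
lemma weighted_coeffs_summable:
  fixes a :: "int \<Rightarrow> complex"
  assumes r: "r > 1/2"
    and a: "(\<lambda>n. (1 + (of_int n)\<^sup>2) powr r * (cmod (a n))\<^sup>2) summable_on UNIV"
  shows "(\<lambda>n. cmod (a n)) summable_on UNIV"
    and "(\<Sum>\<^sub>\<infinity>n. cmod (a n)) \<le>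
           sqrt (\<Sum>\<^sub>\<infinity>n::int. (1 + (of_int n)\<^sup>2) powr (- r)) * sqrt (\<Sum>\<^sub>\<infinity>n::int. (1 + (of_int n)\<^sup>2) powr r * (cmod (a n))\<^sup>2)"
proof -
  define w where "w = (\<lambda>n::int. 1 + (of_int n)\<^sup>2 :: real)"
  have w: "w n > 0" for n
    unfolding w_def by (simp add: add_pos_nonneg)
  have sqw: "(w n powr b)\<^sup>2 = w n powr (2 * b)" for n b
    using w[of n] by (simp add: powr_power)
  define p q where "p = (\<lambda>n. w n powr (- r / 2))"
    and "q = (\<lambda>n. w n powr (r / 2) * cmod (a n))"
  have p2: "(\<lambda>n. (p n)\<^sup>2) = (\<lambda>n. w n powr (- r))"
    unfolding p_def sqw by simp
  have q2: "(\<lambda>n. (q n)\<^sup>2) = (\<lambda>n. w n powr r * (cmod (a n))\<^sup>2)"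
    unfolding q_def power_mult_distrib sqw by simp
  have "w n powr (- r / 2) * w n powr (r / 2) = 1" for n
    using w[of n] by (simp add: powr_add [symmetric])
  then have pq: "(\<lambda>n. p n * q n) = (\<lambda>n. cmod (a n))"
    unfolding p_def q_def by (simp add: mult.assoc [symmetric])
  have sp: "(\<lambda>n. (p n)\<^sup>2) summable_on UNIV"
    unfolding p2 w_def by (rule summable_on_int_weight[OF r])
  have sq: "(\<lambda>n. (q n)\<^sup>2) summable_on UNIV"
    unfolding q2 w_def by (rule a)
  have nonneg: "p n \<ge> 0" "q n \<ge> 0" for n
    by (auto simp: p_def q_def)
  show "(\<lambda>n. cmod (a n)) summable_on UNIV"
    using infsum_Cauchy_Schwarz(1)[OF sp sq nonneg] by (simp add: pq)
  show "(\<Sum>\<^sub>\<infinity>n. cmod (a n)) \<le>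
           sqrt (\<Sum>\<^sub>\<infinity>n::int. (1 + (of_int n)\<^sup>2) powr (- r)) * sqrt (\<Sum>\<^sub>\<infinity>n::int. (1 + (of_int n)\<^sup>2) powr r * (cmod (a n))\<^sup>2)"
    using infsum_Cauchy_Schwarz(2)[OF sp sq nonneg]
    unfolding pq p2 q2 w_def .
qed

lemma sobolev_coeffs_summable:
  assumes r: "r > 1/2" and f: "f \<in> sobolev r"
  shows "(\<lambda>n. cmod (fourier_coeff f n)) summable_on UNIV"
    and "(\<Sum>\<^sub>\<infinity>n. cmod (fourier_coeff f n)) \<le>
           sqrt (\<Sum>\<^sub>\<infinity>n::int. (1 + (of_int n)\<^sup>2) powr (- r)) * sobolev_norm r f"
  using weighted_coeffs_summable[OF r sobolevD(2)[OF f]] by (simp_all add: sobolev_norm_def)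

definition wave_series :: "(int \<Rightarrow> complex) \<Rightarrow> real \<Rightarrow> complex" where
  "wave_series a x = (\<Sum>\<^sub>\<infinity>n. a n * wave n x)"

lemma wave_series_uniform_limit:
  assumes "(\<lambda>n. cmod (a n)) summable_on UNIV"
  shows "uniform_limit S (\<lambda>F x. \<Sum>n\<in>F. a n * wave n x) (wave_series a) (finite_subsets_at_top UNIV)"
  unfolding wave_series_def
  by (rule Weierstrass_m_test_general[OF _ assms]) (simp add: norm_mult)

lemma continuous_on_wave_series:
  assumes "(\<lambda>n. cmod (a n)) summable_on UNIV"
  shows "continuous_on S (wave_series a)"
  by (rule uniform_limit_theorem[OF _ wave_series_uniform_limit[OF assms]])
     (auto intro!: always_eventually continuous_intros)

lemma wave_series_has_sum:
  assumes "(\<lambda>n. cmod (a n)) summable_on UNIV"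
  shows "((\<lambda>n. a n * wave n x) has_sum wave_series a x) UNIV"
  unfolding wave_series_def
  by (rule has_sum_infsum, rule abs_summable_summable) (simp add: norm_mult assms)

lemma norm_wave_series_le:
  assumes "(\<lambda>n. cmod (a n)) summable_on UNIV"
  shows "cmod (wave_series a x) \<le> (\<Sum>\<^sub>\<infinity>n. cmod (a n))"
  using norm_infsum_bound[of "\<lambda>n. a n * wave n x" UNIV] assms
  by (simp add: norm_mult wave_series_def)

text \<open>
  Termwise integration against a continuous function.  Taking \<open>h\<close> to be a wave recovers the
  coefficients of the series; taking \<open>h\<close> to be a function times a wave yields the convolution formula
  for the coefficients of a product.
\<close>
lemma wave_series_integral:
  assumes a: "(\<lambda>n. cmod (a n)) summable_on UNIV" and h: "continuous_on {0..1} h"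
  shows "((\<lambda>n. a n * integral {0..1} (\<lambda>x. wave n x * h x)) has_sum
           integral {0..1} (\<lambda>x. wave_series a x * h x)) UNIV"
proof -
  have "bounded (h ` {0..1})"
    by (intro compact_imp_bounded compact_continuous_image h) auto
  moreover have "bounded (wave_series a ` {0..1})"
    by (intro compact_imp_bounded compact_continuous_image continuous_on_wave_series a) auto
  ultimately have "uniform_limit {0..1} (\<lambda>F x. (\<Sum>n\<in>F. a n * wave n x) * h x)
      (\<lambda>x. wave_series a x * h x) (finite_subsets_at_top UNIV)"
    by (intro uniform_lim_mult wave_series_uniform_limit a uniform_limit_const)
  then obtain I J where IJ: "\<And>F. ((\<lambda>x. (\<Sum>n\<in>F. a n * wave n x) * h x) has_integral I F) {0..1}"
      "((\<lambda>x. wave_series a x * h x) has_integral J) {0..1}" "(I \<longlongrightarrow> J) (finite_subsets_at_top UNIV)"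
    by (rule uniform_limit_integral) (auto intro!: continuous_intros h)
  have "I F = (\<Sum>n\<in>F. a n * integral {0..1} (\<lambda>x. wave n x * h x))" for F
  proof (cases "finite F")
    case True
    have "((\<lambda>x. \<Sum>n\<in>F. a n * (wave n x * h x)) has_integral
            (\<Sum>n\<in>F. a n * integral {0..1} (\<lambda>x. wave n x * h x))) {0..1}"
      by (intro has_integral_sum True has_integral_mult_right integrable_integral
          integrable_continuous_interval continuous_intros h)
    also have "(\<lambda>x. \<Sum>n\<in>F. a n * (wave n x * h x)) = (\<lambda>x. (\<Sum>n\<in>F. a n * wave n x) * h x)"
      by (simp only: sum_distrib_right mult.assoc)
    finally show ?thesis
      by (rule has_integral_unique[OF IJ(1)])
  next
    case False
    then have "((\<lambda>x. 0 :: complex) has_integral I F) {0..1::real}" using IJ(1)[of F] by simp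
    then have "I F = 0" by (rule has_integral_unique) (rule has_integral_0)
    with False show ?thesis by simp
  qed
  then have "I = (\<lambda>F. \<Sum>n\<in>F. a n * integral {0..1} (\<lambda>x. wave n x * h x))"
    by blast
  with IJ(3) have "((\<lambda>n. a n * integral {0..1} (\<lambda>x. wave n x * h x)) has_sum J) UNIV"
    by (simp only: has_sum_def)
  moreover have "integral {0..1} (\<lambda>x. wave_series a x * h x) = J"
    by (rule integral_unique[OF IJ(2)])
  ultimately show ?thesis by simp
qed

lemma fourier_coeff_uminus:
  assumes "circle_fun f"
  shows "fourier_coeff f (- n) = cnj (fourier_coeff f n)"
  by (simp add: fourier_coeff_eq_integral assms integral_cnj cnj_wave)

lemma fourier_coeff_0:
  assumes f: "circle_fun f"
  shows "fourier_coeff f 0 = of_real (mean f)"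
proof -
  have "((\<lambda>x. complex_of_real (f x)) has_integral of_real (mean f)) {0..1}"
    unfolding mean_eq_integral[OF f]
    by (intro has_integral_of_real integrable_integral integrable_continuous_interval circle_funD f)
  then show ?thesis
    by (simp add: fourier_coeff_eq_integral[OF f] integral_unique)
qed

text \<open>
  The symmetry of the coefficients says that the series is invariant under conjugation, since
  conjugating its terms amounts to the reindexing \<open>n \<mapsto> - n\<close>; hence the sum is real.
\<close>
theorem circle_fun_with_coeffs:
  assumes a: "(\<lambda>n. cmod (a n)) summable_on UNIV" and real: "\<And>n. a (- n) = cnj (a n)"
  obtains g where "circle_fun g" "\<And>n. fourier_coeff g n = a n"
    "\<And>x. of_real (g x) = wave_series a x"
proof -
  define g where "g = (\<lambda>x. Re (wave_series a x))"
  have real: "of_real (g x) = wave_series a x" for x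
  proof -
    have "((\<lambda>n. cnj (a n * wave n x)) has_sum cnj (wave_series a x)) UNIV"
      using wave_series_has_sum[OF a] by (simp only: has_sum_cnj_iff)
    also have "(\<lambda>n. cnj (a n * wave n x)) = (\<lambda>n. a n * wave n x) \<circ> uminus"
      by (simp add: o_def real cnj_wave)
    finally have "((\<lambda>n. a n * wave n x) has_sum cnj (wave_series a x)) (range uminus)"
      by (subst has_sum_reindex) (auto simp: o_def)
    then have "cnj (wave_series a x) = wave_series a x"
      using wave_series_has_sum[OF a, of x] by (auto dest: has_sum_unique)
    then show ?thesis
      by (simp add: g_def complex_eq_iff)
  qed
  have g: "circle_fun g"
    unfolding circle_fun_def
  proof (intro conjI allI)
    show "g (x + 1) = g x" for x by (simp add: g_def wave_series_def)
    show "continuous_on UNIV g"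
      unfolding g_def by (intro continuous_intros continuous_on_wave_series a)
  qed
  have "fourier_coeff g m = a m" for m
  proof -
    have "((\<lambda>n. a n * integral {0..1} (\<lambda>x. wave n x * wave (- m) x)) has_sum fourier_coeff g m) UNIV"
      unfolding fourier_coeff_eq_integral[OF g] real
      by (intro wave_series_integral a continuous_intros)
    moreover have "integral {0..1} (\<lambda>x. wave n x * wave (- m) x) = (if n = m then 1 else 0)" for n
      unfolding wave_mult using integral_wave[of "n - m"] by simp
    ultimately have "((\<lambda>n. if n = m then a m else 0) has_sum fourier_coeff g m) UNIV"
      by (simp cong: if_cong add: if_distrib[of "(*) _"])
    moreover have "((\<lambda>n. if n = m then a m else 0) has_sum a m) UNIV"
      by (rule has_sum_finite_neutralI[of "{m}"]) auto
    ultimately show ?thesis by (rule has_sum_unique)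
  qed
  with g real that show ?thesis by blast
qed

text \<open>
  The sum of the series is a continuous function with the same coefficients as \<open>f\<close>, so uniqueness
  identifies the two.
\<close>
theorem fourier_inversion:
  assumes f: "circle_fun f" and a: "(\<lambda>n. cmod (fourier_coeff f n)) summable_on UNIV"
  shows "of_real (f x) = wave_series (fourier_coeff f) x"
proof -
  obtain g where g: "circle_fun g" "\<And>n. fourier_coeff g n = fourier_coeff f n"
      "\<And>x. of_real (g x) = wave_series (fourier_coeff f) x"
    using circle_fun_with_coeffs[OF a fourier_coeff_uminus[OF f]] by blast
  have "f = g"
    using circle_fun_eqI_fourier_coeff[OF f g(1)] g(2) by simp
  with g(3) show ?thesis by simp
qed

theorem sobolev_embedding:
  assumes "r > 1/2"
  obtains C where "C \<ge> 0" "\<And>f x. f \<in> sobolev r \<Longrightarrow> \<bar>f x\<bar> \<le> C * sobolev_norm r f"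
proof -
  define C where "C = sqrt (\<Sum>\<^sub>\<infinity>n::int. (1 + (of_int n)\<^sup>2) powr (- r))"
  have "\<bar>f x\<bar> \<le> C * sobolev_norm r f" if f: "f \<in> sobolev r" for f x
  proof -
    note s = sobolev_coeffs_summable[OF assms f]
    have "\<bar>f x\<bar> = cmod (of_real (f x))" by simp
    also have "\<dots> = cmod (wave_series (fourier_coeff f) x)"
      using fourier_inversion[OF sobolevD(1)[OF f] s(1)] by simp
    also have "\<dots> \<le> C * sobolev_norm r f"
      unfolding C_def by (rule order_trans[OF norm_wave_series_le[OF s(1)] s(2)])
    finally show ?thesis .
  qed
  moreover have "C \<ge> 0" unfolding C_def by (auto intro: infsum_nonneg)
  ultimately show ?thesis using that by blast
qed

lemma sobolev_linear:
  assumes "f \<in> sobolev r" "g \<in> sobolev r"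
  shows "(\<lambda>x. a * f x + b * g x) \<in> sobolev r"
proof (rule sobolevI)
  note f = sobolevD[OF assms(1)] and g = sobolevD[OF assms(2)]
  show "circle_fun (\<lambda>x. a * f x + b * g x)"
    by (rule circle_fun_linear[OF f(1) g(1)])
  have "(\<lambda>n::int. 2 * a\<^sup>2 * ((1 + (of_int n)\<^sup>2) powr r * (cmod (fourier_coeff f n))\<^sup>2) +
               2 * b\<^sup>2 * ((1 + (of_int n)\<^sup>2) powr r * (cmod (fourier_coeff g n))\<^sup>2)) summable_on UNIV"
    by (intro summable_on_add summable_on_cmult_right f g)
  then show "(\<lambda>n::int. (1 + (of_int n)\<^sup>2) powr r *
      (cmod (fourier_coeff (\<lambda>x. a * f x + b * g x) n))\<^sup>2) summable_on UNIV"
  proof (rule summable_on_comparison_test)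
    fix n :: int
    define u v where "u = a * fourier_coeff f n" and "v = b * fourier_coeff g n"
    have "(cmod (u + v))\<^sup>2 \<le> (cmod u + cmod v)\<^sup>2"
      by (intro power_mono norm_triangle_ineq) auto
    also have "\<dots> \<le> 2 * (cmod u)\<^sup>2 + 2 * (cmod v)\<^sup>2"
      using sum_squares_bound[of "cmod u" "cmod v"] by (simp add: power2_sum)
    also have "\<dots> = 2 * a\<^sup>2 * (cmod (fourier_coeff f n))\<^sup>2 + 2 * b\<^sup>2 * (cmod (fourier_coeff g n))\<^sup>2"
      by (simp add: u_def v_def norm_mult power_mult_distrib)
    finally have "(1 + (of_int n)\<^sup>2) powr r * (cmod (u + v))\<^sup>2 \<le> (1 + (of_int n)\<^sup>2) powr r *
        (2 * a\<^sup>2 * (cmod (fourier_coeff f n))\<^sup>2 + 2 * b\<^sup>2 * (cmod (fourier_coeff g n))\<^sup>2)"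
      by (intro mult_left_mono) auto
    then show "(1 + (of_int n)\<^sup>2) powr r * (cmod (fourier_coeff (\<lambda>x. a * f x + b * g x) n))\<^sup>2 \<le>
        2 * a\<^sup>2 * ((1 + (of_int n)\<^sup>2) powr r * (cmod (fourier_coeff f n))\<^sup>2) +
        2 * b\<^sup>2 * ((1 + (of_int n)\<^sup>2) powr r * (cmod (fourier_coeff g n))\<^sup>2)"
      unfolding fourier_coeff_linear[OF f(1) g(1)] u_def v_def by (simp add: algebra_simps)
  qed auto
qed

section \<open>Derivatives of Sobolev functions\<close>

text \<open>
  The increment of an antiderivative over one period is constant, and its value is the mean of \<open>D\<close>.
\<close>
lemma circle_fun_antiderivative:
  assumes D: "circle_fun D" and "mean D = 0"
  obtains G where "circle_fun G" "\<And>x. (G has_real_derivative D x) (at x)"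
proof -
  have "\<exists>G. \<forall>x::real. - \<infinity> < ereal x \<longrightarrow> ereal x < \<infinity> \<longrightarrow> (G has_vector_derivative D x) (at x)"
    by (rule einterval_antiderivative)
       (use circle_funD(2)[OF D, of UNIV] in \<open>auto simp: continuous_on_eq_continuous_at\<close>)
  then obtain G where G: "(G has_real_derivative D x) (at x)" for x
    by (auto simp: has_real_derivative_iff_has_vector_derivative)
  have "((\<lambda>x. G (x + 1) - G x) has_real_derivative 0) (at x)" for x
    using DERIV_diff[OF DERIV_shift[THEN iffD1, OF G[of "x + 1"]] G[of x]] circle_funD(1)[OF D]
    by simp
  then have "G (x + 1) - G x = G (0 + 1) - G 0" for x
    using DERIV_isconst_all[of "\<lambda>x. G (x + 1) - G x" x 0] by blast
  then have shift: "G (x + 1) - G x = G 1 - G 0" for x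
    by simp
  have "(D has_integral (G 1 - G 0)) {0..1}"
    by (intro fundamental_theorem_of_calculus)
       (auto simp: has_real_derivative_iff_has_vector_derivative[symmetric] intro: DERIV_subset G)
  then have "G 1 - G 0 = 0"
    using assms by (simp add: mean_eq_integral integral_unique)
  then have "G (x + 1) = G x" for x
    using shift[of x] by simp
  moreover have "continuous_on UNIV G"
    by (rule DERIV_continuous_on[of _ _ D]) (simp add: G)
  ultimately show ?thesis
    using G that by (auto simp: circle_fun_def)
qed

lemma fourier_coeff_derivative:
  assumes G: "circle_fun G" and D: "circle_fun D"
    and deriv: "\<And>x. (G has_real_derivative D x) (at x)"
  shows "fourier_coeff D n = 2 * pi * of_int n * \<i> * fourier_coeff G n"
proof -
  let ?c = "2 * pi * of_int n * \<i>"
  have "((\<lambda>x. of_real (D x) * wave (- n) x - ?c * (of_real (G x) * wave (- n) x)) has_integral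
      (of_real (G 1) * wave (- n) 1 - of_real (G 0) * wave (- n) 0)) {0..1}"
  proof (rule fundamental_theorem_of_calculus)
    fix x :: real
    have "((\<lambda>x. of_real (G x)) has_vector_derivative complex_of_real (D x)) (at x within {0..1})"
      by (intro has_vector_derivative_of_real)
         (use deriv[of x] in \<open>auto simp: has_real_derivative_iff_has_vector_derivative
            intro: has_vector_derivative_at_within\<close>)
    from has_vector_derivative_mult[OF this wave_has_vector_derivative, of "- n"]
    show "((\<lambda>x. of_real (G x) * wave (- n) x) has_vector_derivative
        of_real (D x) * wave (- n) x - ?c * (of_real (G x) * wave (- n) x)) (at x within {0..1})"
      by (simp add: algebra_simps)
  qed simp
  moreover have "of_real (G 1) * wave (- n) 1 - of_real (G 0) * wave (- n) 0 = 0"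
    using wave_periodic[of "- n" 0] circle_funD(1)[OF G, of 0] by simp
  ultimately have "((\<lambda>x. of_real (D x) * wave (- n) x - ?c * (of_real (G x) * wave (- n) x)) has_integral 0) {0..1}"
    by simp
  moreover have "((\<lambda>x. of_real (D x) * wave (- n) x - ?c * (of_real (G x) * wave (- n) x)) has_integral
      fourier_coeff D n - ?c * fourier_coeff G n) {0..1}"
    unfolding fourier_coeff_eq_integral[OF G] fourier_coeff_eq_integral[OF D]
    by (intro has_integral_diff has_integral_mult_right integrable_integral
        integrable_continuous_interval continuous_intros circle_funD G D)
  ultimately have "0 = fourier_coeff D n - ?c * fourier_coeff G n"
    by (rule has_integral_unique)
  then show ?thesis by simp
qed

lemma circle_fun_const: "circle_fun (\<lambda>x. c)"
  by (simp add: circle_fun_def)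

lemma fourier_coeff_const: "fourier_coeff (\<lambda>x. c) n = (if n = 0 then c else 0)"
  by (simp add: fourier_coeff_eq_integral circle_fun_const integral_wave)

lemma mean_const: "mean (\<lambda>x. c) = c"
  by (simp add: mean_eq_integral circle_fun_const)

lemma mean_linear:
  assumes "circle_fun f" "circle_fun g"
  shows "mean (\<lambda>x. a * f x + b * g x) = a * mean f + b * mean g"
proof -
  have "complex_of_real (mean (\<lambda>x. a * f x + b * g x)) = of_real (a * mean f + b * mean g)"
    using fourier_coeff_linear[OF assms, of a b 0]
    by (simp add: fourier_coeff_0 circle_fun_linear assms)
  then show ?thesis
    by (simp only: of_real_eq_iff)
qed

lemma mean_nonneg:
  assumes "circle_fun f" "\<And>x. f x \<ge> 0"
  shows "mean f \<ge> 0"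
  using assms by (auto simp: mean_eq_integral intro!: integral_nonneg
      integrable_continuous_interval circle_funD)

lemma weight_mono_derivative:
  "(1 + (of_int n)\<^sup>2) powr (s - 1) * (cmod (2 * pi * of_int n * \<i> * c))\<^sup>2 \<le>
     4 * pi\<^sup>2 * ((1 + (of_int n)\<^sup>2) powr s * (cmod c)\<^sup>2)"
proof -
  define w where "w = 1 + (real_of_int n)\<^sup>2"
  have w: "w > 0" "(real_of_int n)\<^sup>2 \<le> w" by (auto simp: w_def add_pos_nonneg)
  have "w powr (s - 1) * (cmod (2 * pi * of_int n * \<i> * c))\<^sup>2 =
        4 * pi\<^sup>2 * (w powr (s - 1) * (real_of_int n)\<^sup>2 * (cmod c)\<^sup>2)"
    by (simp add: norm_mult power_mult_distrib)
  also have "\<dots> \<le> 4 * pi\<^sup>2 * (w powr (s - 1) * w * (cmod c)\<^sup>2)"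
    using w by (intro mult_left_mono mult_right_mono) auto
  also have "w powr (s - 1) * w = w powr s"
    using w by (simp add: powr_diff)
  finally show ?thesis by (simp add: w_def)
qed

text \<open>
  The coefficients expected of the derivative are absolutely summable, so they belong to a continuous
  function \<open>D\<close> of mean zero.  A periodic antiderivative of \<open>D\<close>, normalised to the mean of \<open>f\<close>, has the
  coefficients of \<open>f\<close>, hence equals \<open>f\<close>.  This replaces termwise differentiation by the uniqueness
  theorem.
\<close>
theorem sobolev_differentiable:
  assumes s: "s > 3/2" and f: "f \<in> sobolev s"
  shows "(f has_real_derivative deriv f x) (at x)"
    and "deriv f \<in> sobolev (s - 1)"
    and "sobolev_norm (s - 1) (deriv f) \<le> 2 * pi * sobolev_norm s f"
proof -
  define a where "a = (\<lambda>n. 2 * pi * of_int n * \<i> * fourier_coeff f n)"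
  have f0: "circle_fun f" by (rule sobolevD[OF f])
  have sum4: "(\<lambda>n::int. 4 * pi\<^sup>2 * ((1 + (of_int n)\<^sup>2) powr s * (cmod (fourier_coeff f n))\<^sup>2)) summable_on UNIV"
    by (intro summable_on_cmult_right sobolevD f)
  then have suma: "(\<lambda>n::int. (1 + (of_int n)\<^sup>2) powr (s - 1) * (cmod (a n))\<^sup>2) summable_on UNIV"
    by (rule summable_on_comparison_test) (unfold a_def, rule weight_mono_derivative, simp)
  have "(\<lambda>n. cmod (a n)) summable_on UNIV"
    using weighted_coeffs_summable(1)[OF _ suma] s by simp
  moreover have "a (- n) = cnj (a n)" for n
    by (simp add: a_def fourier_coeff_uminus f0)
  ultimately obtain D where D: "circle_fun D" "\<And>n. fourier_coeff D n = a n"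
    by (rule circle_fun_with_coeffs) blast
  have "mean D = 0"
    using fourier_coeff_0[OF D(1)] D(2)[of 0] by (simp add: a_def)
  then obtain G where G: "circle_fun G" "\<And>x. (G has_real_derivative D x) (at x)"
    using circle_fun_antiderivative[OF D(1)] by blast
  \<comment> \<open>Written as a linear combination so that the linearity lemmas apply literally.\<close>
  define H where "H = (\<lambda>x. 1 * G x + 1 * (mean f - mean G))"
  have "fourier_coeff H n = fourier_coeff f n" for n
  proof (cases "n = 0")
    case True
    then show ?thesis
      unfolding H_def fourier_coeff_linear[OF G(1) circle_fun_const]
      by (simp add: fourier_coeff_const fourier_coeff_0 f0 G(1))
  next
    case False
    have "a n = 2 * pi * of_int n * \<i> * fourier_coeff G n"
      using fourier_coeff_derivative[OF G(1) D(1) G(2), of n] D(2) by simp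
    then have "fourier_coeff G n = fourier_coeff f n"
      using False by (simp add: a_def)
    with False show ?thesis
      unfolding H_def fourier_coeff_linear[OF G(1) circle_fun_const]
      by (simp add: fourier_coeff_const)
  qed
  then have "H = f"
    by (intro circle_fun_eqI_fourier_coeff f0) (simp_all only: H_def circle_fun_linear G(1) circle_fun_const)
  moreover have "(H has_real_derivative D x) (at x)" for x
    unfolding H_def by (auto intro!: derivative_eq_intros G)
  ultimately have der: "(f has_real_derivative D x) (at x)" for x
    by simp
  then have dD: "deriv f = D"
    by (auto intro: DERIV_imp_deriv)
  show "(f has_real_derivative deriv f x) (at x)"
    unfolding dD by (rule der)
  show "deriv f \<in> sobolev (s - 1)"
    unfolding dD by (rule sobolevI) (use D suma in auto)
  have "(sobolev_norm (s - 1) D)\<^sup>2 \<le> (2 * pi * sobolev_norm s f)\<^sup>2"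
  proof -
    have "(\<Sum>\<^sub>\<infinity>n::int. (1 + (of_int n)\<^sup>2) powr (s - 1) * (cmod (a n))\<^sup>2) \<le>
        (\<Sum>\<^sub>\<infinity>n::int. 4 * pi\<^sup>2 * ((1 + (of_int n)\<^sup>2) powr s * (cmod (fourier_coeff f n))\<^sup>2))"
      by (rule infsum_mono[OF suma sum4]) (unfold a_def, rule weight_mono_derivative)
    also have "\<dots> = 4 * pi\<^sup>2 * (\<Sum>\<^sub>\<infinity>n::int. (1 + (of_int n)\<^sup>2) powr s * (cmod (fourier_coeff f n))\<^sup>2)"
      by (rule infsum_cmult_right')
    finally show ?thesis
      by (simp add: sobolev_norm_def D(2) power_mult_distrib infsum_nonneg)
  qed
  then show "sobolev_norm (s - 1) (deriv f) \<le> 2 * pi * sobolev_norm s f"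
    unfolding dD by (rule power2_le_imp_le) (simp add: sobolev_norm_nonneg)
qed

section \<open>Squares of Sobolev functions\<close>

lemma peetre_inequality:
  fixes x y :: real
  assumes "r \<ge> 0"
  shows "(1 + (x + y)\<^sup>2) powr r \<le> 4 powr r * ((1 + x\<^sup>2) powr r + (1 + y\<^sup>2) powr r)"
proof -
  have le: "(1 + (x + y)\<^sup>2) powr r \<le> 4 powr r * (1 + z\<^sup>2) powr r"
    if "x\<^sup>2 \<le> z\<^sup>2" "y\<^sup>2 \<le> z\<^sup>2" for z
  proof -
    have "1 + (x + y)\<^sup>2 \<le> 4 * (1 + z\<^sup>2)"
      using that sum_squares_bound[of x y] by (simp add: power2_sum)
    then have "(1 + (x + y)\<^sup>2) powr r \<le> (4 * (1 + z\<^sup>2)) powr r"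
      using assms by (intro powr_mono2) auto
    also have "\<dots> = 4 powr r * (1 + z\<^sup>2) powr r"
      by (intro powr_mult)
    finally show ?thesis .
  qed
  show ?thesis
  proof (cases "x\<^sup>2 \<le> y\<^sup>2")
    case True
    then have "(1 + (x + y)\<^sup>2) powr r \<le> 4 powr r * (1 + y\<^sup>2) powr r"
      by (intro le) auto
    also have "\<dots> \<le> 4 powr r * ((1 + x\<^sup>2) powr r + (1 + y\<^sup>2) powr r)"
      by (intro mult_left_mono) auto
    finally show ?thesis .
  next
    case False
    then have "(1 + (x + y)\<^sup>2) powr r \<le> 4 powr r * (1 + x\<^sup>2) powr r"
      by (intro le) auto
    also have "\<dots> \<le> 4 powr r * ((1 + x\<^sup>2) powr r + (1 + y\<^sup>2) powr r)"
      by (intro mult_left_mono) auto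
    finally show ?thesis .
  qed
qed

lemma fourier_coeff_square_has_sum:
  assumes f: "circle_fun f" and sum: "(\<lambda>n. cmod (fourier_coeff f n)) summable_on UNIV"
  shows "((\<lambda>k. fourier_coeff f k * fourier_coeff f (n - k)) has_sum fourier_coeff (\<lambda>x. (f x)\<^sup>2) n) UNIV"
proof -
  have f2: "circle_fun (\<lambda>x. (f x)\<^sup>2)"
    using f by (auto simp: circle_fun_def intro!: continuous_intros)
  let ?h = "\<lambda>x. of_real (f x) * wave (- n) x"
  have "((\<lambda>k. fourier_coeff f k * integral {0..1} (\<lambda>x. wave k x * ?h x)) has_sum
      integral {0..1} (\<lambda>x. wave_series (fourier_coeff f) x * ?h x)) UNIV"
    by (intro wave_series_integral sum continuous_intros circle_funD f)
  also have "(\<lambda>x. wave_series (fourier_coeff f) x * ?h x) = (\<lambda>x. of_real ((f x)\<^sup>2) * wave (- n) x)"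
    by (simp add: fourier_inversion[OF f sum, symmetric] power2_eq_square mult.assoc)
  also have "integral {0..1} \<dots> = fourier_coeff (\<lambda>x. (f x)\<^sup>2) n"
    by (simp only: fourier_coeff_eq_integral[OF f2])
  also have "(\<lambda>k. fourier_coeff f k * integral {0..1} (\<lambda>x. wave k x * ?h x)) =
      (\<lambda>k. fourier_coeff f k * fourier_coeff f (n - k))"
  proof
    fix k
    have "wave k x * ?h x = of_real (f x) * wave (- (n - k)) x" for x
      using wave_mult[of k x "- n"] by (simp add: mult.left_commute)
    then have "(\<lambda>x. wave k x * ?h x) = (\<lambda>x. of_real (f x) * wave (- (n - k)) x)"
      by (rule ext)
    then show "fourier_coeff f k * integral {0..1} (\<lambda>x. wave k x * ?h x) =
        fourier_coeff f k * fourier_coeff f (n - k)"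
      by (simp only: fourier_coeff_eq_integral[OF f])
  qed
  finally show ?thesis .
qed

lemma has_sum_finite_sum:
  fixes f :: "'a \<Rightarrow> 'b \<Rightarrow> real"
  assumes "finite N" "\<And>n. n \<in> N \<Longrightarrow> (f n has_sum s n) K"
  shows "((\<lambda>k. \<Sum>n\<in>N. f n k) has_sum (\<Sum>n\<in>N. s n)) K"
  using assms by (induction N rule: finite_induct) (auto intro!: has_sum_add)

text \<open>
  Young's inequality: the convolution of an \<open>l\<^sup>1\<close> and an \<open>l\<^sup>2\<close> sequence is in \<open>l\<^sup>2\<close>.  Splitting
  \<open>A k * W (n - k)\<close> into \<open>sqrt (A k)\<close> and \<open>sqrt (A k) * W (n - k)\<close>, Cauchy-Schwarz bounds the square of
  the convolution by \<open>S1\<close> times the convolution of \<open>A\<close> with \<open>W\<^sup>2\<close>, and the latter is summed over finite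
  sets of \<open>n\<close> first.
\<close>
lemma young_convolution:
  fixes A W :: "int \<Rightarrow> real"
  assumes A: "A summable_on UNIV" and W: "(\<lambda>n. (W n)\<^sup>2) summable_on UNIV"
    and nonneg: "\<And>n. A n \<ge> 0" "\<And>n. W n \<ge> 0"
  shows "(\<lambda>k. A k * W (n - k)) summable_on UNIV"
    and "(\<lambda>n. (\<Sum>\<^sub>\<infinity>k. A k * W (n - k))\<^sup>2) summable_on UNIV"
proof -
  define S1 S2 where "S1 = (\<Sum>\<^sub>\<infinity>k. A k)" and "S2 = (\<Sum>\<^sub>\<infinity>k. (W k)\<^sup>2)"
  have S: "S1 \<ge> 0" "S2 \<ge> 0"
    by (auto simp: S1_def S2_def intro!: infsum_nonneg nonneg)
  have sum_W_le: "(\<Sum>n\<in>N. (W (n - k))\<^sup>2) \<le> S2" if "finite N" for N k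
  proof -
    have "(\<Sum>n\<in>N. (W (n - k))\<^sup>2) = (\<Sum>m\<in>(\<lambda>n. n - k) ` N. (W m)\<^sup>2)"
      by (subst sum.reindex) (auto simp: inj_on_def)
    also have "\<dots> \<le> S2"
      unfolding S2_def using that by (intro finite_sum_le_infsum W) auto
    finally show ?thesis .
  qed
  have W2: "(W m)\<^sup>2 \<le> S2" for m
    using sum_W_le[of "{m}" 0] by simp
  have sumAW: "(\<lambda>k. A k * (W (n - k))\<^sup>2) summable_on UNIV" for n
  proof (rule summable_on_comparison_test)
    show "(\<lambda>k. A k * S2) summable_on UNIV"
      by (intro summable_on_cmult_left A)
  qed (auto intro!: mult_left_mono mult_nonneg_nonneg W2 nonneg)
  define p where "p = (\<lambda>k. sqrt (A k))"
  define q where "q = (\<lambda>n k. sqrt (A k) * W (n - k))"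
  have p2: "(\<lambda>k. (p k)\<^sup>2) = A"
    by (auto simp: p_def nonneg)
  have q2: "(\<lambda>k. (q n k)\<^sup>2) = (\<lambda>k. A k * (W (n - k))\<^sup>2)" for n
    by (auto simp: q_def power_mult_distrib nonneg)
  have pq: "(\<lambda>k. p k * q n k) = (\<lambda>k. A k * W (n - k))" for n
    by (auto simp: p_def q_def nonneg simp flip: mult.assoc)
  have "p k \<ge> 0" "q n k \<ge> 0" for n k
    by (auto simp: p_def q_def nonneg)
  note CS = infsum_Cauchy_Schwarz[of p "q n" for n, unfolded p2 q2 pq, OF A sumAW this]
  show "(\<lambda>k. A k * W (n - k)) summable_on UNIV"
    by (rule CS(1))
  have sq: "(\<Sum>\<^sub>\<infinity>k. A k * W (n - k))\<^sup>2 \<le> S1 * (\<Sum>\<^sub>\<infinity>k. A k * (W (n - k))\<^sup>2)" for n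
  proof -
    have "(\<Sum>\<^sub>\<infinity>k. A k * W (n - k))\<^sup>2 \<le> (sqrt S1 * sqrt (\<Sum>\<^sub>\<infinity>k. A k * (W (n - k))\<^sup>2))\<^sup>2"
      unfolding S1_def by (intro power_mono CS(2)) (auto intro!: infsum_nonneg nonneg mult_nonneg_nonneg)
    also have "\<dots> = S1 * (\<Sum>\<^sub>\<infinity>k. A k * (W (n - k))\<^sup>2)"
      using S by (simp add: power_mult_distrib infsum_nonneg nonneg)
    finally show ?thesis .
  qed
  show "(\<lambda>n. (\<Sum>\<^sub>\<infinity>k. A k * W (n - k))\<^sup>2) summable_on UNIV"
  proof (rule nonneg_bdd_above_summable_on)
    have "(\<Sum>n\<in>N. (\<Sum>\<^sub>\<infinity>k. A k * W (n - k))\<^sup>2) \<le> S1 * (S1 * S2)" if N: "finite N" for N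
    proof -
      have "(\<Sum>n\<in>N. (\<Sum>\<^sub>\<infinity>k. A k * W (n - k))\<^sup>2) \<le> (\<Sum>n\<in>N. S1 * (\<Sum>\<^sub>\<infinity>k. A k * (W (n - k))\<^sup>2))"
        by (intro sum_mono sq)
      also have "\<dots> = S1 * (\<Sum>n\<in>N. \<Sum>\<^sub>\<infinity>k. A k * (W (n - k))\<^sup>2)"
        by (simp add: sum_distrib_left)
      also have "(\<Sum>n\<in>N. \<Sum>\<^sub>\<infinity>k. A k * (W (n - k))\<^sup>2) = (\<Sum>\<^sub>\<infinity>k. \<Sum>n\<in>N. A k * (W (n - k))\<^sup>2)"
        by (rule infsumI[symmetric], rule has_sum_finite_sum) (auto intro!: has_sum_infsum sumAW N)
      also have "\<dots> \<le> (\<Sum>\<^sub>\<infinity>k. A k * S2)"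
      proof (rule infsum_mono)
        show "(\<lambda>k. \<Sum>n\<in>N. A k * (W (n - k))\<^sup>2) summable_on UNIV"
          by (rule has_sum_imp_summable, rule has_sum_finite_sum) (auto intro!: has_sum_infsum sumAW N)
        show "(\<lambda>k. A k * S2) summable_on UNIV"
          by (intro summable_on_cmult_left A)
        show "(\<Sum>n\<in>N. A k * (W (n - k))\<^sup>2) \<le> A k * S2" for k
          unfolding sum_distrib_left [symmetric] by (intro mult_left_mono sum_W_le N nonneg)
      qed
      also have "(\<Sum>\<^sub>\<infinity>k. A k * S2) = S1 * S2"
        unfolding S1_def by (rule infsum_cmult_left')
      finally show ?thesis using S by (simp add: mult_left_mono)
    qed
    then show "bdd_above (sum (\<lambda>n. (\<Sum>\<^sub>\<infinity>k. A k * W (n - k))\<^sup>2) ` {F. F \<subseteq> UNIV \<and> finite F})"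
      by (auto intro!: bdd_aboveI)
  qed simp
qed

text \<open>
  The source term of the equation contains the square of the slope, and inverting \<open>opA\<close> on it is
  meaningful only if this square stays in the same space.  The coefficients of the square are the
  convolution of those of \<open>f\<close> with themselves.  By the inequality of Peetre the weight \<open>w n\<close> is at most
  a constant times \<open>w k + w (n - k)\<close>, so the weighted coefficients are bounded by a convolution of the
  \<open>l\<^sup>1\<close> sequence \<open>A\<close> with the \<open>l\<^sup>2\<close> sequence \<open>W\<close>.
\<close>
theorem sobolev_square:
  assumes r: "r > 1/2" and f: "f \<in> sobolev r"
  shows "(\<lambda>x. (f x)\<^sup>2) \<in> sobolev r"
proof (rule sobolevI)
  have f0: "circle_fun f" by (rule sobolevD[OF f])
  show "circle_fun (\<lambda>x. (f x)\<^sup>2)"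
    using f0 by (auto simp: circle_fun_def intro!: continuous_intros)
  define w where "w = (\<lambda>n::int. (1 + (of_int n)\<^sup>2) powr (r / 2) :: real)"
  define A where "A = (\<lambda>n. cmod (fourier_coeff f n))"
  define W where "W = (\<lambda>n. w n * A n)"
  have w2: "(w n)\<^sup>2 = (1 + (of_int n)\<^sup>2) powr r" for n
  proof -
    have "1 + (real_of_int n)\<^sup>2 \<noteq> 0"
      using zero_le_power2[of "real_of_int n"] by linarith
    then show ?thesis
      unfolding w_def by (simp add: powr_power)
  qed
  have A: "A summable_on UNIV"
    unfolding A_def by (rule sobolev_coeffs_summable[OF r f])
  have W2: "(\<lambda>n. (W n)\<^sup>2) summable_on UNIV"
    using sobolevD(2)[OF f] by (simp add: W_def power_mult_distrib w2 A_def)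
  have nonneg: "A n \<ge> 0" "W n \<ge> 0" for n
    by (auto simp: A_def W_def w_def)
  note young = young_convolution[OF A W2 nonneg]
  define Y where "Y = (\<lambda>n. \<Sum>\<^sub>\<infinity>k. A k * W (n - k))"
  have sumAW: "(\<lambda>k. A k * W (n - k)) summable_on UNIV" for n
    by (rule young(1))
  have bij: "bij_betw (\<lambda>k. n - k) UNIV (UNIV :: int set)" for n
    by (rule bij_betwI[where g = "\<lambda>k. n - k"]) auto
  have sumWA: "((\<lambda>k. W k * A (n - k)) has_sum Y n) UNIV" for n
  proof -
    have "((\<lambda>k. A k * W (n - k)) has_sum Y n) UNIV"
      unfolding Y_def by (rule has_sum_infsum[OF sumAW])
    then have "((\<lambda>k. A (n - k) * W (n - (n - k))) has_sum Y n) UNIV"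
      by (subst has_sum_reindex_bij_betw[OF bij])
    then show ?thesis by (simp add: mult.commute)
  qed
  define C where "C = 2 * 4 powr (r / 2)"
  have bound: "w n * cmod (fourier_coeff (\<lambda>x. (f x)\<^sup>2) n) \<le> C * Y n" for n
  proof -
    let ?c = "\<lambda>k. fourier_coeff f k * fourier_coeff f (n - k)"
    have "((\<lambda>k. 4 powr (r / 2) * (W k * A (n - k) + A k * W (n - k))) has_sum
            4 powr (r / 2) * (Y n + Y n)) UNIV"
      by (intro has_sum_cmult_right has_sum_add sumWA) (unfold Y_def, rule has_sum_infsum[OF sumAW])
    then have S: "((\<lambda>k. 4 powr (r / 2) * (W k * A (n - k) + A k * W (n - k))) has_sum C * Y n) UNIV"
      by (simp add: C_def algebra_simps)
    have le: "w n * cmod (?c k) \<le> 4 powr (r / 2) * (W k * A (n - k) + A k * W (n - k))" for k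
    proof -
      have "w n \<le> 4 powr (r / 2) * (w k + w (n - k))"
        unfolding w_def using peetre_inequality[of "r / 2" "of_int k" "of_int (n - k)"] r by simp
      then have "w n * (A k * A (n - k)) \<le> (4 powr (r / 2) * (w k + w (n - k))) * (A k * A (n - k))"
        by (intro mult_right_mono) (auto simp: A_def)
      also have "\<dots> = 4 powr (r / 2) * (W k * A (n - k) + A k * W (n - k))"
        by (simp add: W_def algebra_simps)
      finally show ?thesis by (simp add: A_def norm_mult)
    qed
    have "((\<lambda>k. of_real (w n) * ?c k) has_sum of_real (w n) * fourier_coeff (\<lambda>x. (f x)\<^sup>2) n) UNIV"
      by (intro has_sum_cmult_right fourier_coeff_square_has_sum f0 sobolev_coeffs_summable[OF r f])
    from norm_infsum_le[OF this S]
    have "cmod (of_real (w n) * fourier_coeff (\<lambda>x. (f x)\<^sup>2) n) \<le> C * Y n"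
      using le by (simp add: norm_mult w_def)
    then show ?thesis by (simp add: norm_mult w_def)
  qed
  have "(\<lambda>n. C\<^sup>2 * (Y n)\<^sup>2) summable_on UNIV"
    unfolding Y_def by (intro summable_on_cmult_right young(2))
  then show "(\<lambda>n::int. (1 + (of_int n)\<^sup>2) powr r * (cmod (fourier_coeff (\<lambda>x. (f x)\<^sup>2) n))\<^sup>2) summable_on UNIV"
  proof (rule summable_on_comparison_test)
    fix n :: int
    have "(w n * cmod (fourier_coeff (\<lambda>x. (f x)\<^sup>2) n))\<^sup>2 \<le> (C * Y n)\<^sup>2"
      by (intro power_mono bound) (simp add: w_def)
    then show "(1 + (of_int n)\<^sup>2) powr r * (cmod (fourier_coeff (\<lambda>x. (f x)\<^sup>2) n))\<^sup>2 \<le> C\<^sup>2 * (Y n)\<^sup>2"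
      by (simp only: power_mult_distrib w2)
  qed simp
qed

section \<open>The inverse of the operator A\<close>

lemma circle_fun_constant_derivative:
  assumes h: "circle_fun h" and deriv: "\<And>x. (h has_real_derivative c) (at x)"
  shows "c = 0" and "h x = h y"
proof -
  have "((\<lambda>x::real. c) has_integral (h 1 - h 0)) {0..1}"
    by (intro fundamental_theorem_of_calculus)
       (auto simp: has_real_derivative_iff_has_vector_derivative[symmetric] intro: DERIV_subset deriv)
  moreover have "((\<lambda>x::real. c) has_integral c) {0..1}"
    using has_integral_const_real[of c 0 1] by simp
  ultimately have "c = h 1 - h 0"
    using has_integral_unique by blast
  with circle_funD(1)[OF h, of 0] show c: "c = 0" by simp
  show "h x = h y"
    using deriv unfolding c by (intro DERIV_isconst_all) auto
qed

text \<open>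
  If \<open>opA v = opA w\<close>, then the second derivative of \<open>v - w\<close> is constant, and a periodic function with
  constant derivative is constant.  Applied to the first derivative this shows that \<open>v\<close> and \<open>w\<close> have
  the same mean; applied to \<open>v - w\<close> itself it shows that \<open>v - w\<close> is a constant of mean zero.
\<close>
lemma opA_inj_on:
  assumes r: "r > 1/2"
  shows "inj_on opA (sobolev (r + 2))"
proof (rule inj_onI)
  fix v w assume v: "v \<in> sobolev (r + 2)" and w: "w \<in> sobolev (r + 2)" and eq: "opA v = opA w"
  have r2: "r + 2 > 3/2" "r + 2 - 1 > 3/2" using r by auto
  note v0 = sobolevD(1)[OF v] and w0 = sobolevD(1)[OF w]
  note v1 = sobolev_differentiable[OF r2(1) v] and w1 = sobolev_differentiable[OF r2(1) w]
  note v2 = sobolev_differentiable[OF r2(2) v1(2)] and w2 = sobolev_differentiable[OF r2(2) w1(2)]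
  define d where "d = (\<lambda>x. 1 * v x + (- 1) * w x)"
  define d1 where "d1 = (\<lambda>x. 1 * deriv v x + (- 1) * deriv w x)"
  have d0: "circle_fun d" unfolding d_def by (intro circle_fun_linear v0 w0)
  have d10: "circle_fun d1"
    unfolding d1_def by (intro circle_fun_linear sobolevD(1)[OF v1(2)] sobolevD(1)[OF w1(2)])
  have d': "(d has_real_derivative d1 x) (at x)" for x
    unfolding d_def d1_def by (auto intro!: derivative_eq_intros v1 w1)
  have "deriv (deriv v) x - deriv (deriv w) x = mean v - mean w" for x
    using fun_cong[OF eq, of x] by (simp add: opA_def)
  then have d1': "(d1 has_real_derivative (mean v - mean w)) (at x)" for x
    unfolding d1_def by (auto intro!: derivative_eq_intros v2 w2 simp: algebra_simps)
  from circle_fun_constant_derivative[OF d10 d1']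
  have means: "mean v = mean w" and d1_const: "d1 x = d1 0" for x by auto
  have "(d has_real_derivative d1 0) (at x)" for x
    using d'[of x] d1_const[of x] by simp
  from circle_fun_constant_derivative(2)[OF d0 this]
  have const: "d = (\<lambda>x. d 0)" by auto
  have "mean d = 0"
    using mean_linear[OF v0 w0, of 1 "-1"] means by (simp add: d_def)
  then have "d 0 = 0"
    using const mean_const[of "d 0"] by simp
  then have "d x = 0" for x using const by metis
  then show "v = w" by (auto simp: d_def)
qed

text \<open>
  The preimage is obtained by integrating \<open>mean f - f\<close> twice, normalising to mean zero after the
  first and to \<open>mean f\<close> after the second step.  Each integration divides the \<open>n\<close>-th Fourier
  coefficient by \<open>2 * pi * n * \<i>\<close>, which gains the two orders of regularity.
\<close>
lemma opA_surj:
  assumes r: "r > 1/2" and f: "f \<in> sobolev r"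
  obtains w where "w \<in> sobolev (r + 2)" "opA w = f"
    "\<And>x. (deriv w has_real_derivative mean f - f x) (at x)"
proof -
  have f0: "circle_fun f" by (rule sobolevD[OF f])
  define g where "g = (\<lambda>x. mean f * 1 + (- 1) * f x)"
  have g: "circle_fun g" unfolding g_def by (intro circle_fun_linear f0 circle_fun_const)
  have "mean g = 0"
    unfolding g_def mean_linear[OF circle_fun_const f0] by (simp add: mean_const)
  then obtain G0 where G0: "circle_fun G0" "\<And>x. (G0 has_real_derivative g x) (at x)"
    using circle_fun_antiderivative[OF g] by blast
  define G where "G = (\<lambda>x. 1 * G0 x + (- mean G0) * 1)"
  have G: "circle_fun G" unfolding G_def by (intro circle_fun_linear G0 circle_fun_const)
  have G': "(G has_real_derivative g x) (at x)" for x
    unfolding G_def by (auto intro!: derivative_eq_intros G0)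
  have "mean G = 0"
    unfolding G_def mean_linear[OF G0(1) circle_fun_const] by (simp add: mean_const)
  then obtain W0 where W0: "circle_fun W0" "\<And>x. (W0 has_real_derivative G x) (at x)"
    using circle_fun_antiderivative[OF G] by blast
  define w where "w = (\<lambda>x. 1 * W0 x + (mean f - mean W0) * 1)"
  have w: "circle_fun w" unfolding w_def by (intro circle_fun_linear W0 circle_fun_const)
  have w': "(w has_real_derivative G x) (at x)" for x
    unfolding w_def by (auto intro!: derivative_eq_intros W0)
  have mean_w: "mean w = mean f"
    unfolding w_def mean_linear[OF W0(1) circle_fun_const] by (simp add: mean_const)
  have dw: "deriv w = G" and dG: "deriv G = g"
    using w' G' by (auto intro: DERIV_imp_deriv)
  have "opA w = f"
    by (simp add: opA_def dw dG mean_w g_def)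
  moreover have "w \<in> sobolev (r + 2)"
  proof (rule sobolevI[OF w summable_on_comparison_test[OF sobolevD(2)[OF f]]])
    fix n :: int
    show "(1 + (of_int n)\<^sup>2) powr (r + 2) * (cmod (fourier_coeff w n))\<^sup>2 \<le>
          (1 + (of_int n)\<^sup>2) powr r * (cmod (fourier_coeff f n))\<^sup>2"
    proof (cases "n = 0")
      case True
      then show ?thesis by (simp add: fourier_coeff_0 w f0 mean_w)
    next
      case False
      define q where "q = 1 + (real_of_int n)\<^sup>2"
      have n1: "(real_of_int n)\<^sup>2 \<ge> 1"
        using False by (simp flip: of_int_power add: int_one_le_iff_zero_less)
      have q: "q > 0" unfolding q_def using n1 by linarith
      have "fourier_coeff g n = - fourier_coeff f n"
        unfolding g_def fourier_coeff_linear[OF circle_fun_const f0] using False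
        by (simp add: fourier_coeff_const)
      moreover have "fourier_coeff g n = (2 * pi * of_int n * \<i>) * ((2 * pi * of_int n * \<i>) * fourier_coeff w n)"
        using fourier_coeff_derivative[OF G g G', of n] fourier_coeff_derivative[OF w G w', of n] by simp
      ultimately have "cmod (fourier_coeff f n) =
          cmod ((2 * pi * of_int n * \<i>) * ((2 * pi * of_int n * \<i>) * fourier_coeff w n))"
        by (metis norm_minus_cancel)
      then have fw: "cmod (fourier_coeff f n) = (2 * pi)\<^sup>2 * (real_of_int n)\<^sup>2 * cmod (fourier_coeff w n)"
        by (simp add: norm_mult power2_eq_square algebra_simps)
      have "q \<le> 2 * (real_of_int n)\<^sup>2" using n1 by (simp add: q_def)
      also have "\<dots> \<le> (2 * pi)\<^sup>2 * (real_of_int n)\<^sup>2"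
      proof (rule mult_right_mono)
        have "2 \<le> 2 * pi" using pi_ge_two by simp
        then have "2\<^sup>2 \<le> (2 * pi)\<^sup>2" by (rule power_mono) simp
        then show "2 \<le> (2 * pi)\<^sup>2" by simp
      qed simp
      finally have "q * cmod (fourier_coeff w n) \<le> cmod (fourier_coeff f n)"
        unfolding fw by (intro mult_right_mono) auto
      then have "(q * cmod (fourier_coeff w n))\<^sup>2 \<le> (cmod (fourier_coeff f n))\<^sup>2"
        using q by (intro power_mono) auto
      then have "q powr r * (q * cmod (fourier_coeff w n))\<^sup>2 \<le> q powr r * (cmod (fourier_coeff f n))\<^sup>2"
        by (intro mult_left_mono) auto
      moreover have "q powr (r + 2) = q powr r * q\<^sup>2"
        using q by (simp add: powr_add)
      ultimately show ?thesis
        unfolding q_def [symmetric] by (simp add: power_mult_distrib mult.assoc)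
    qed
  qed simp
  ultimately show ?thesis
    using that[of w] G' by (simp add: dw dG g_def)
qed

text \<open>
  This turns the derivative of the nonlocal term into a local expression and a mean, whose signs can
  be read off when \<open>f\<close> is half a square.
\<close>
theorem opA_inv_second_derivative:
  assumes r: "r > 1/2" and f: "f \<in> sobolev r"
  shows "(deriv (opA_inv r f) has_real_derivative mean f - f x) (at x)"
proof -
  obtain w where w: "w \<in> sobolev (r + 2)" "opA w = f"
      "\<And>x. (deriv w has_real_derivative mean f - f x) (at x)"
    by (rule opA_surj[OF r f], rule that)
  have "opA_inv r f = w"
    unfolding opA_inv_def using the_inv_into_f_f[OF opA_inj_on[OF r] w(1)] w(2) by simp
  with w(3) show ?thesis by simp
qed

section \<open>Blow-up of the slope for classical solutions\<close>

text \<open>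
  Passes from continuity in time with values in a function space, where \<open>N t \<tau>\<close> dominates the sup
  distance of the values at \<open>t\<close> and \<open>\<tau>\<close>, to joint continuity in time and space.
\<close>
lemma continuous_on_Times_of_uniform:
  fixes v N :: "real \<Rightarrow> real \<Rightarrow> real"
  assumes cont: "\<And>t. t \<in> I \<Longrightarrow> continuous_on UNIV (v t)"
    and lim: "\<And>t. t \<in> I \<Longrightarrow> (N t \<longlongrightarrow> 0) (at t within I)"
    and le: "\<And>t \<tau> x. t \<in> I \<Longrightarrow> \<tau> \<in> I \<Longrightarrow> \<bar>v \<tau> x - v t x\<bar> \<le> N t \<tau>"
  shows "continuous_on (I \<times> UNIV) (\<lambda>z. v (fst z) (snd z))"
  unfolding continuous_on_iff
proof (safe, goal_cases)
  case (1 t x e)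
  then have t: "t \<in> I" and e: "e > 0" by auto
  from lim[OF t] e obtain d1 where d1: "d1 > 0"
      "\<And>\<tau>. \<tau> \<in> I \<Longrightarrow> \<tau> \<noteq> t \<Longrightarrow> dist \<tau> t < d1 \<Longrightarrow> dist (N t \<tau>) 0 < e / 2"
    unfolding tendsto_iff eventually_at by (metis half_gt_zero)
  from cont[OF t] e obtain d2 where d2: "d2 > 0" "\<And>y. dist y x < d2 \<Longrightarrow> dist (v t y) (v t x) < e / 2"
    unfolding continuous_on_iff by (metis UNIV_I half_gt_zero)
  show ?case
  proof (rule exI[of _ "min d1 d2"], safe, goal_cases)
    case (2 \<tau> y)
    then have \<tau>: "\<tau> \<in> I" and near: "dist (\<tau>, y) (t, x) < d1" "dist (\<tau>, y) (t, x) < d2" by auto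
    have "dist \<tau> t < d1" "dist y x < d2"
      using near dist_fst_le[of "(\<tau>, y)" "(t, x)"] dist_snd_le[of "(\<tau>, y)" "(t, x)"] by auto
    have "\<bar>v \<tau> y - v t y\<bar> < e / 2"
    proof (cases "\<tau> = t")
      case False
      have "\<bar>v \<tau> y - v t y\<bar> \<le> N t \<tau>" by (rule le[OF t \<tau>])
      also have "N t \<tau> < e / 2"
        using d1(2)[OF \<tau> False \<open>dist \<tau> t < d1\<close>] by (simp add: dist_real_def)
      finally show ?thesis .
    qed (use e in auto)
    moreover have "\<bar>v t y - v t x\<bar> < e / 2"
      using d2(2)[OF \<open>dist y x < d2\<close>] by (simp add: dist_real_def)
    ultimately have "\<bar>v \<tau> y - v t x\<bar> < e" by linarith
    then show ?case by (simp add: dist_real_def)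
  qed (use d1 d2 in auto)
qed

text \<open>
  Here \<open>g\<close> is a difference quotient and \<open>p\<close>, \<open>q\<close> are slopes at nearby points.  If all three agree, the
  left-hand side is \<open>- g\<^sup>2 / 2 - lam * g\<close>, which for \<open>g \<le> - a\<close> is at most \<open>- \<delta> / (2 * a) * g\<^sup>2\<close>.
  Half of this coefficient is given away to absorb the errors of size \<open>\<epsilon>\<close>.
\<close>
lemma riccati_margin:
  fixes lam \<delta> \<epsilon> a p g q :: real
  assumes lam: "lam > 0" and \<delta>: "\<delta> > 0" and \<epsilon>: "\<epsilon> > 0" "\<epsilon> \<le> \<delta> / 40" "\<epsilon> \<le> a"
    and a: "a = 2 * lam + \<delta>" and b: "g \<le> - a"
    and p: "\<bar>p - g\<bar> \<le> \<epsilon>" and q: "\<bar>q - g\<bar> \<le> \<epsilon>"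
  shows "- p * g + 1/2 * q\<^sup>2 - lam * g < - (\<delta> / (4 * a)) * g\<^sup>2"
proof -
  define b where "b = - g"
  have b: "b \<ge> a" "b > 0" and a0: "a > 0" using assms by (auto simp: b_def)
  have "- p * g = - b\<^sup>2 + (p - g) * b"
    by (simp add: b_def power2_eq_square algebra_simps)
  also have "(p - g) * b \<le> \<epsilon> * b"
    using p b by (intro mult_right_mono) auto
  finally have 1: "- p * g \<le> - b\<^sup>2 + \<epsilon> * b" by simp
  have "\<bar>q\<bar> \<le> b + \<epsilon>" using q b by (simp add: b_def)
  then have "q\<^sup>2 \<le> (b + \<epsilon>)\<^sup>2"
    using abs_le_square_iff[of q "b + \<epsilon>"] b \<epsilon> by simp
  then have 2: "1/2 * q\<^sup>2 \<le> 1/2 * b\<^sup>2 + b * \<epsilon> + 1/2 * \<epsilon>\<^sup>2"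
    by (simp add: power2_sum)
  have lhs: "- p * g + 1/2 * q\<^sup>2 - lam * g \<le> - (1/2) * b\<^sup>2 + 2 * \<epsilon> * b + 1/2 * \<epsilon>\<^sup>2 + lam * b"
    using 1 2 by (simp add: b_def algebra_simps)
  have "a * (lam * b) \<le> b * (lam * b)"
    using b lam by (intro mult_right_mono) auto
  then have i1: "2 * a * (lam * b) \<le> (a - \<delta>) * b\<^sup>2"
    by (simp add: a power2_eq_square algebra_simps)
  have ab: "a * b \<le> b\<^sup>2" "a * a \<le> b\<^sup>2"
    using b a0 by (auto simp: power2_eq_square intro: mult_mono)
  have "\<epsilon> * (a * b) \<le> (\<delta> / 40) * b\<^sup>2"
    using \<epsilon> ab b a0 by (intro mult_mono) auto
  then have i2: "4 * a * (\<epsilon> * b) \<le> (\<delta> / 10) * b\<^sup>2"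
    by (simp add: algebra_simps)
  have "\<epsilon> * (\<epsilon> * a) \<le> \<epsilon> * (a * a)"
    using \<epsilon> a0 by (intro mult_left_mono mult_right_mono) auto
  also have "\<dots> \<le> (\<delta> / 40) * b\<^sup>2"
    using \<epsilon> ab a0 by (intro mult_mono) auto
  finally have i3: "a * \<epsilon>\<^sup>2 \<le> (\<delta> / 40) * b\<^sup>2"
    by (simp add: power2_eq_square algebra_simps)
  have b2: "\<delta> * b\<^sup>2 > 0" using \<delta> b by simp
  have "2 * a * (- (1/2) * b\<^sup>2 + 2 * \<epsilon> * b + 1/2 * \<epsilon>\<^sup>2 + lam * b) =
      - a * b\<^sup>2 + 4 * a * (\<epsilon> * b) + a * \<epsilon>\<^sup>2 + 2 * a * (lam * b)"
    by (simp add: algebra_simps)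
  also have "\<dots> \<le> - a * b\<^sup>2 + (\<delta> / 10) * b\<^sup>2 + (\<delta> / 40) * b\<^sup>2 + (a - \<delta>) * b\<^sup>2"
    using i1 i2 i3 by linarith
  also have "\<dots> < - (\<delta> / 2) * b\<^sup>2"
    using b2 by (simp add: algebra_simps)
  also have "\<dots> = 2 * a * (- (\<delta> / (4 * a)) * b\<^sup>2)"
    using a0 by (simp add: field_simps)
  finally have "- (1/2) * b\<^sup>2 + 2 * \<epsilon> * b + 1/2 * \<epsilon>\<^sup>2 + lam * b < - (\<delta> / (4 * a)) * b\<^sup>2"
    using a0 by (subst (asm) mult_less_cancel_left_pos) auto
  with lhs have "- p * g + 1/2 * q\<^sup>2 - lam * g < - (\<delta> / (4 * a)) * b\<^sup>2"
    by linarith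
  then show ?thesis by (simp add: b_def)
qed

lemma closed_progress_reaches_end:
  fixes S :: "real set"
  assumes "closed S" "S \<subseteq> {0..b}" "S \<noteq> {}"
    and progress: "\<And>t. t \<in> S \<Longrightarrow> t < b \<Longrightarrow> \<exists>\<tau>\<in>S. t < \<tau>"
  shows "b \<in> S"
proof -
  have bdd: "bdd_above S" using assms(2) by (meson bdd_above_Icc bdd_above_mono)
  have "Sup S \<in> S"
    by (rule closed_contains_Sup[OF assms(3) bdd assms(1)])
  moreover have "\<not> Sup S < b"
    using progress[OF \<open>Sup S \<in> S\<close>] cSup_upper[OF _ bdd] by force
  ultimately show ?thesis using assms(2) by force
qed

text \<open>
  The first \<open>x\<close>-derivative of a solution is only continuous, so its minimum cannot be differentiated in
  time.  The difference quotient \<open>g t x = (u t (x + h) - u t x) / h\<close> can: if \<open>x\<close> is a minimum point of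
  \<open>g t\<close>, then \<open>ux t (x + h) = ux t x\<close>, so the transport terms at both ends combine to
  \<open>- ux t x * g t x\<close>, which is close to \<open>- (g t x)\<^sup>2\<close>.  The increment of \<open>F\<close> contributes at most half
  the square of a nearby slope, and hence the time derivative of \<open>g\<close> at \<open>(t, x)\<close> is below
  \<open>- k * (g t x)\<^sup>2\<close>.

  The minimum of \<open>g t\<close> is therefore kept below the solution \<open>\<phi>\<close> of \<open>\<phi>' = - k * \<phi>\<^sup>2\<close>, \<open>\<phi> 0 = - a\<close>,
  which tends to \<open>- \<infinity>\<close> at the time \<open>T = 1 / (a * k)\<close>.  This contradicts the bound for \<open>ux\<close> on the
  compact set \<open>{0..T} \<times> {0..2}\<close>.  The step \<open>h\<close> is chosen once, from the uniform continuity of \<open>ux\<close> on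
  this set; the interval \<open>{0..2}\<close> contains \<open>x + h\<close> for all \<open>x\<close> in one period.
\<close>
theorem classical_slope_blowup:
  fixes u ux ut F Fx :: "real \<Rightarrow> real \<Rightarrow> real"
  assumes lam: "lam > 0"
    and per: "\<And>t. t \<ge> 0 \<Longrightarrow> circle_fun (u t)"
    and contu: "continuous_on ({0..} \<times> UNIV) (\<lambda>z. u (fst z) (snd z))"
    and contux: "continuous_on ({0..} \<times> UNIV) (\<lambda>z. ux (fst z) (snd z))"
    and ux: "\<And>t x. t \<ge> 0 \<Longrightarrow> (u t has_real_derivative ux t x) (at x)"
    and ut: "\<And>t x. t \<ge> 0 \<Longrightarrow> ((\<lambda>\<tau>. u \<tau> x) has_real_derivative ut t x) (at t within {0..})"
    and eq: "\<And>t x. t \<ge> 0 \<Longrightarrow> ut t x = - (u t x * ux t x) + F t x - lam * u t x"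
    and F: "\<And>t x. t \<ge> 0 \<Longrightarrow> (F t has_real_derivative Fx t x) (at x)"
    and Fx: "\<And>t x. t \<ge> 0 \<Longrightarrow> Fx t x \<le> 1/2 * (ux t x)\<^sup>2"
    and steep: "ux 0 0 < - 2 * lam"
  shows False
proof -
  \<comment> \<open>Half of the excess of the initial slope over the threshold is kept as the margin \<open>\<delta>\<close>;
  the other half lets the difference quotient at the origin start at \<open>- a\<close> or below.\<close>
  define \<delta> where "\<delta> = (- 2 * lam - ux 0 0) / 2"
  define a where "a = 2 * lam + \<delta>"
  define k where "k = \<delta> / (4 * a)"
  define T where "T = 1 / (a * k)"
  define \<phi> where "\<phi> = (\<lambda>t. - 1 / (1 / a - k * t))"
  define \<epsilon> where "\<epsilon> = min (\<delta> / 40) a"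
  have \<delta>: "\<delta> > 0" and ux00: "ux 0 0 = - a - \<delta>"
    using steep by (auto simp: \<delta>_def a_def field_simps)
  have a: "a > 0" using lam \<delta> by (simp add: a_def)
  have k: "k > 0" using a \<delta> by (simp add: k_def)
  have T: "T > 0" using a k by (simp add: T_def)
  have \<epsilon>: "\<epsilon> > 0" "\<epsilon> \<le> \<delta> / 40" "\<epsilon> \<le> a" "\<epsilon> \<le> \<delta>" using \<delta> a by (auto simp: \<epsilon>_def)
  have den: "1 / a - k * t > 0" if "t < T" for t
    using that a k by (simp add: T_def field_simps)
  have \<phi>_le: "\<phi> t \<le> - a" if "0 \<le> t" "t < T" for t
  proof -
    have "1 / a - k * t \<le> 1 / a" using that k by simp
    then have "1 / (1 / a) \<le> 1 / (1 / a - k * t)"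
      using den[OF that(2)] a by (intro divide_left_mono mult_pos_pos) auto
    then show ?thesis using a by (simp add: \<phi>_def)
  qed
  have \<phi>': "(\<phi> has_real_derivative - k * (\<phi> t)\<^sup>2) (at t within X)" if "t < T" for t X
    using den[OF that] unfolding \<phi>_def
    by (auto intro!: derivative_eq_intros simp: power2_eq_square field_simps)

  let ?K = "{0..T} \<times> {0..2::real}"
  have K: "compact ?K" by (intro compact_Times) auto
  have contK: "continuous_on ?K (\<lambda>z. ux (fst z) (snd z))"
    by (rule continuous_on_subset[OF contux]) auto
  have "bounded ((\<lambda>z. ux (fst z) (snd z)) ` ?K)"
    by (rule compact_imp_bounded[OF compact_continuous_image[OF contK K]])
  then obtain M where "\<forall>y \<in> (\<lambda>z. ux (fst z) (snd z)) ` ?K. norm y \<le> M"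
    unfolding bounded_iff by (rule exE)
  then have M: "\<bar>ux (fst z) (snd z)\<bar> \<le> M" if "z \<in> ?K" for z
    using that by auto
  have unif: "uniformly_continuous_on ?K (\<lambda>z. ux (fst z) (snd z))"
    by (rule compact_uniformly_continuous[OF contK K])
  obtain h0 where h0: "h0 > 0" and h0_close: "\<forall>z\<in>?K. \<forall>z'\<in>?K. dist z' z < h0 \<longrightarrow>
      dist (ux (fst z') (snd z')) (ux (fst z) (snd z)) < \<epsilon>"
    by (rule unif[unfolded uniformly_continuous_on_def, THEN spec, THEN mp, OF \<epsilon>(1), THEN exE])
       (elim conjE, rule that)
  define h where "h = min 1 (h0 / 2)"
  have h: "h > 0" "h \<le> 1" "h < h0" using h0 by (auto simp: h_def)
  have close: "\<bar>ux t y - ux t z\<bar> \<le> \<epsilon>"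
    if "t \<in> {0..T}" "x \<in> {0..1}" "y \<in> {x..x+h}" "z \<in> {x..x+h}" for t x y z
  proof -
    have "dist (t, y) (t, z) < h0"
      using that h by (auto simp: dist_Pair_Pair dist_real_def)
    moreover have "(t, z) \<in> ?K" "(t, y) \<in> ?K" using that h by auto
    ultimately have "dist (ux t y) (ux t z) < \<epsilon>"
      using h0_close[THEN bspec, THEN bspec, THEN mp, of "(t, z)" "(t, y)"] by simp
    then show ?thesis by (simp add: dist_real_def)
  qed
  define g where "g = (\<lambda>t x. (u t (x + h) - u t x) / h)"
  have g_mvt: "\<exists>\<eta>\<in>{x..x+h}. g t x = ux t \<eta>" if t: "t \<ge> 0" for t x
  proof -
    have "\<exists>z. x < z \<and> z < x + h \<and> u t (x + h) - u t x = (x + h - x) * ux t z"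
      using h(1) by (intro MVT2) (auto intro: ux[OF t])
    then show ?thesis using h(1) by (force simp: g_def field_simps)
  qed
  have g_close: "\<bar>ux t y - g t x\<bar> \<le> \<epsilon>" if "t \<in> {0..T}" "x \<in> {0..1}" "y \<in> {x..x+h}" for t x y
    using g_mvt[of t x] close[OF that(1,2,3)] that(1) by auto
  have g_circle: "circle_fun (g t)" if "t \<ge> 0" for t
  proof -
    have "continuous_on UNIV (g t)"
      unfolding g_def by (intro continuous_intros continuous_on_compose2[OF circle_funD(2)[OF per[OF that]]])
        (use h in auto)
    moreover have "g t (x + 1) = g t x" for x
      using circle_funD(1)[OF per[OF that], of x] circle_funD(1)[OF per[OF that], of "x + h"]
      by (simp add: g_def add.commute add.left_commute)
    ultimately show ?thesis by (simp add: circle_fun_def)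
  qed

  \<comment> \<open>At a minimum point \<open>x\<close> of \<open>g t\<close> the difference \<open>g - \<phi>\<close> is nonpositive and strictly
  decreasing in time, so the same \<open>x\<close> serves as a witness shortly after \<open>t\<close>.\<close>
  have descend: "\<exists>x\<in>{0..1}. \<exists>d>0. \<forall>\<tau>. t < \<tau> \<longrightarrow> \<tau> < t + d \<longrightarrow> g \<tau> x - \<phi> \<tau> < 0"
    if t: "0 \<le> t" "t < T" and "\<exists>x\<in>{0..1}. g t x \<le> \<phi> t" for t
  proof -
    obtain x where x: "x \<in> {0..1}" "\<And>y. y \<in> {0..1} \<Longrightarrow> g t x \<le> g t y"
      using continuous_attains_inf[of "{0..1}" "g t"] circle_funD(2)[OF g_circle[OF t(1)]] by auto
    have gx: "g t x \<le> \<phi> t" using that(3) x(2) by force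
    have min: "g t x \<le> g t y" for y
    proof -
      have "frac y \<in> {0..1}" using frac_lt_1[of y] by (auto intro: less_imp_le)
      from x(2)[OF this] show ?thesis by (simp add: circle_fun_frac[OF g_circle[OF t(1)]])
    qed
    have "((\<lambda>y. u t (y + h)) has_real_derivative ux t (x + h)) (at x)"
      using DERIV_shift[of "u t" "ux t (x + h)" x h] ux[OF t(1), of "x + h"] by simp
    then have "(g t has_real_derivative (ux t (x + h) - ux t x) / h) (at x)"
      unfolding g_def using h by (auto intro!: derivative_eq_intros ux t)
    then have "(ux t (x + h) - ux t x) / h = 0"
      by (rule DERIV_local_min[of _ _ _ 1]) (auto intro: min)
    then have same_slope: "ux t (x + h) = ux t x" using h by simp
    obtain \<xi> where \<xi>: "x < \<xi>" "\<xi> < x + h" "F t (x + h) - F t x = (x + h - x) * Fx t \<xi>"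
      using MVT2[of x "x + h" "F t" "Fx t"] h(1) F[OF t(1)] by auto
    have "(ut t (x + h) - ut t x) / h = - ux t x * g t x + Fx t \<xi> - lam * g t x"
      using \<xi>(3) h(1) unfolding eq[OF t(1)] same_slope g_def by (simp add: field_simps)
    also have "\<dots> \<le> - ux t x * g t x + 1/2 * (ux t \<xi>)\<^sup>2 - lam * g t x"
      using Fx[OF t(1)] by simp
    also have "\<dots> < - k * (g t x)\<^sup>2"
      unfolding k_def
    proof (rule riccati_margin[OF lam \<delta> \<epsilon>(1-3) a_def])
      show "g t x \<le> - a" using gx \<phi>_le[OF t] by simp
      show "\<bar>ux t x - g t x\<bar> \<le> \<epsilon>" "\<bar>ux t \<xi> - g t x\<bar> \<le> \<epsilon>"
        using t x \<xi> h by (auto intro!: g_close)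
    qed
    also have "\<dots> \<le> - k * (\<phi> t)\<^sup>2"
    proof -
      have "(\<phi> t)\<^sup>2 \<le> (g t x)\<^sup>2"
        using gx \<phi>_le[OF t] a abs_le_square_iff[of "\<phi> t" "g t x"] by auto
      then show ?thesis using k by simp
    qed
    finally have neg: "(ut t (x + h) - ut t x) / h - (- k * (\<phi> t)\<^sup>2) < 0" by simp
    have "((\<lambda>\<tau>. g \<tau> x - \<phi> \<tau>) has_real_derivative
        (ut t (x + h) - ut t x) / h - (- k * (\<phi> t)\<^sup>2)) (at t within {0..})"
      unfolding g_def
      by (rule DERIV_diff[OF DERIV_cdivide[OF DERIV_diff[OF ut[OF t(1)] ut[OF t(1)]]] \<phi>'[OF t(2)]])
    from has_real_derivative_neg_dec_right[OF this neg]
    obtain d where d: "d > 0" "\<And>e. e > 0 \<Longrightarrow> t + e \<in> {0..} \<Longrightarrow> e < d \<Longrightarrow>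
        g (t + e) x - \<phi> (t + e) < g t x - \<phi> t"
      by auto
    have "g \<tau> x - \<phi> \<tau> < 0" if "t < \<tau>" "\<tau> < t + d" for \<tau>
      using d(2)[of "\<tau> - t"] that t gx by simp
    with x(1) d(1) show ?thesis by blast
  qed

  have reach: "\<exists>x\<in>{0..1}. g b x \<le> \<phi> b" if b: "0 \<le> b" "b < T" for b
  proof -
    \<comment> \<open>The set of times with a witness is the projection of a compact set, hence closed.\<close>
    define C where "C = {z \<in> {0..b} \<times> {0..1}. g (fst z) (snd z) \<le> \<phi> (fst z)}"
    have "continuous_on ({0..b} \<times> {0..1}) (\<lambda>z. g (fst z) (snd z))"
    proof -
      have "continuous_on ({0..b} \<times> {0..1}) (\<lambda>z. u (fst z) (snd z + h))"
      proof -
        have "continuous_on ({0..b} \<times> {0..1}) (\<lambda>z. (fst z, snd z + h))"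
          by (intro continuous_intros)
        moreover have "(\<lambda>z. (fst z, snd z + h)) ` ({0..b} \<times> {0..1}) \<subseteq> {0..} \<times> UNIV"
          by auto
        ultimately show ?thesis
          using continuous_on_compose2[OF contu] by fastforce
      qed
      moreover have "continuous_on ({0..b} \<times> {0..1}) (\<lambda>z. u (fst z) (snd z))"
        by (rule continuous_on_subset[OF contu]) auto
      ultimately show ?thesis
        unfolding g_def using h by (intro continuous_intros) auto
    qed
    moreover have "continuous_on ({0..b} \<times> {0..1::real}) (\<lambda>z. \<phi> (fst z))"
    proof -
      have "continuous_on {0..b} \<phi>"
        by (rule DERIV_continuous_on[where D = "\<lambda>t. - k * (\<phi> t)\<^sup>2"]) (use \<phi>' b in auto)
      then show ?thesis
        by (rule continuous_on_compose2) (auto intro!: continuous_intros)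
    qed
    ultimately have "closed C"
      unfolding C_def by (intro continuous_on_closed_Collect_le closed_Times) auto
    moreover have "C \<subseteq> {0..b} \<times> {0..1}" by (auto simp: C_def)
    moreover have "compact ({0..b} \<times> {0..1::real})" by (intro compact_Times) auto
    ultimately have "compact C"
      by (metis compact_Int_closed inf.absorb_iff2)
    then have closed: "closed (fst ` C)"
      by (intro compact_imp_closed compact_continuous_image continuous_intros)
    have fstC: "t \<in> fst ` C \<longleftrightarrow> t \<in> {0..b} \<and> (\<exists>x\<in>{0..1}. g t x \<le> \<phi> t)" for t
      by (force simp: C_def)
    have start: "0 \<in> fst ` C"
    proof -
      have "g 0 0 \<le> \<phi> 0"
        using g_close[of 0 0 0] T h \<epsilon>(4) ux00 by (simp add: \<phi>_def)
      then show ?thesis unfolding fstC using b by auto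
    qed
    have progress: "\<exists>\<tau>\<in>fst ` C. t < \<tau>" if tC: "t \<in> fst ` C" "t < b" for t
    proof -
      obtain x d where x: "x \<in> {0..1}" and d: "d > 0"
          "\<And>\<tau>. t < \<tau> \<Longrightarrow> \<tau> < t + d \<Longrightarrow> g \<tau> x - \<phi> \<tau> < 0"
        using descend[of t] tC b unfolding fstC by auto
      define \<tau> where "\<tau> = min b (t + d / 2)"
      have "t < \<tau>" "\<tau> < t + d" "\<tau> \<le> b" using d(1) tC by (auto simp: \<tau>_def)
      moreover from this have "\<tau> \<in> fst ` C"
        unfolding fstC using d(2)[of \<tau>] x tC unfolding fstC by (auto intro!: bexI[of _ x])
      ultimately show ?thesis by blast
    qed
    have "b \<in> fst ` C"
    proof (rule closed_progress_reaches_end[OF closed _ _ progress])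
      show "fst ` C \<subseteq> {0..b}" by (auto simp: C_def)
      show "fst ` C \<noteq> {}" using start by blast
    qed
    then show ?thesis unfolding fstC by simp
  qed

  \<comment> \<open>At the time \<open>b < T\<close> with \<open>\<phi> b = - N\<close> the bound \<open>M\<close> is violated.\<close>
  define N where "N = \<bar>M\<bar> + a + 1"
  define b where "b = (1 / a - 1 / N) / k"
  have N: "N > a" "N > M" "N > 0" using a by (auto simp: N_def)
  have kb: "1 / a - k * b = 1 / N" using k by (simp add: b_def)
  have "0 \<le> b" unfolding b_def using k a N by (intro divide_nonneg_pos) (auto intro: frac_le)
  have "b < T"
  proof -
    have "0 < 1 / N" using N(3) by simp
    then have "k * b < 1 / a" using kb by linarith
    then show ?thesis using k a by (simp add: T_def field_simps)
  qed
  obtain x where x: "x \<in> {0..1}" "g b x \<le> \<phi> b"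
    using reach[OF \<open>0 \<le> b\<close> \<open>b < T\<close>] by blast
  obtain \<eta> where \<eta>: "\<eta> \<in> {x..x+h}" "g b x = ux b \<eta>"
    using g_mvt[OF \<open>0 \<le> b\<close>] by blast
  have "\<bar>ux b \<eta>\<bar> \<le> M"
    using M[of "(b, \<eta>)"] x \<eta> h \<open>0 \<le> b\<close> \<open>b < T\<close> by auto
  moreover have "\<phi> b = - N" unfolding \<phi>_def kb by simp
  ultimately show False using x(2) \<eta>(2) N(2) by linarith
qed

section \<open>Odd initial data for the weakly dissipative equation\<close>

text \<open>
  With \<open>G\<close> a periodic antiderivative of \<open>f - mean f\<close>, the periodic function \<open>G x - G (- x)\<close> has the
  constant derivative \<open>- 2 * mean f\<close>.
\<close>
lemma odd_circle_fun_mean_zero: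
  assumes f: "circle_fun f" and odd: "\<And>x. f (- x) = - f x"
  shows "mean f = 0"
proof -
  define g where "g = (\<lambda>x. 1 * f x + (- mean f) * 1)"
  have g: "circle_fun g" unfolding g_def by (intro circle_fun_linear f circle_fun_const)
  have "mean g = 0"
    unfolding g_def mean_linear[OF f circle_fun_const] by (simp add: mean_const)
  then obtain G where G: "circle_fun G" "\<And>x. (G has_real_derivative g x) (at x)"
    using circle_fun_antiderivative[OF g] by blast
  define H where "H = (\<lambda>x. G x - G (- x))"
  have "circle_fun H"
  proof -
    have "G (- (x + 1)) = G (- x)" for x
      using circle_funD(1)[OF G(1), of "- (x + 1)"] by simp
    moreover have "continuous_on UNIV (\<lambda>x. G (- x))"
      by (rule continuous_on_compose2[OF circle_funD(2)[OF G(1), of UNIV]]) (auto intro!: continuous_intros)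
    ultimately show ?thesis
      using circle_funD[OF G(1)] by (auto simp: circle_fun_def H_def intro!: continuous_intros)
  qed
  moreover have "(H has_real_derivative - 2 * mean f) (at x)" for x
  proof -
    have "((\<lambda>x. G (- x)) has_real_derivative - g (- x)) (at x)"
      using DERIV_mirror[of "G" "g (- x)" x] G(2)[of "- x"] by simp
    then show ?thesis
      unfolding H_def by (rule DERIV_cong[OF DERIV_diff[OF G(2)]]) (simp add: g_def odd)
  qed
  ultimately have "- 2 * mean f = 0"
    by (rule circle_fun_constant_derivative(1))
  then show ?thesis by simp
qed

theorem theorem4p3:
  fixes lam s :: real and u0 :: "real \<Rightarrow> real" and T :: ereal and u :: "real \<Rightarrow> real \<Rightarrow> real"
  assumes "lam > 0"
    and "s > 3/2"
    and "u0 \<in> sobolev s"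
    and "maximal_muHS_solution lam s u0 T u"
    and "\<forall>x. u0 (- x) = - u0 x"
    and "deriv u0 0 < - 2 * lam"
  shows "T < \<infinity>"
proof (rule ccontr)
  assume "\<not> T < \<infinity>"
  then have "T = \<infinity>" by simp
  then have I: "time_interval T = {0..}" by (auto simp: time_interval_def)
  have s1: "s - 1 > 1/2" using \<open>s > 3/2\<close> by simp
  obtain ut where
      Cs: "continuous_in_sobolev s {0..} u"
    and C1: "C1_in_sobolev (s - 1) {0..} u ut"
    and eq: "\<And>t x. t \<ge> 0 \<Longrightarrow> ut t x + u t x * deriv (u t) x =
             - deriv (opA_inv (s - 1)
                 (\<lambda>z. 2 * mean u0 * exp (- lam * t) * u t z + 1/2 * (deriv (u t) z)\<^sup>2)) x
             - lam * u t x"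
    and init: "u 0 = u0"
    using \<open>maximal_muHS_solution lam s u0 T u\<close>
    unfolding maximal_muHS_solution_def muHS_solution_def I by auto
  \<comment> \<open>Oddness removes the linear term from the source, so only half the squared slope remains.\<close>
  have mean0: "mean u0 = 0"
    using assms(5) sobolevD(1)[OF \<open>u0 \<in> sobolev s\<close>] by (intro odd_circle_fun_mean_zero) auto
  have us: "u t \<in> sobolev s" if "t \<ge> 0" for t
    using Cs that by (auto simp: continuous_in_sobolev_def)
  have us1: "u t \<in> sobolev (s - 1)" "ut t \<in> sobolev (s - 1)" if "t \<ge> 0" for t
    using C1 that by (auto simp: continuous_in_sobolev_def C1_in_sobolev_def)
  have diff: "(\<lambda>x. u \<tau> x - u t x) \<in> sobolev s" if "t \<ge> 0" "\<tau> \<ge> 0" for t \<tau>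
    using sobolev_linear[OF us us, of \<tau> t 1 "-1"] that by simp
  have lim: "((\<lambda>\<tau>. c * sobolev_norm s (\<lambda>x. u \<tau> x - u t x)) \<longlongrightarrow> 0) (at t within {0..})"
    if "t \<ge> 0" for t c
    using Cs that by (intro tendsto_mult_right_zero) (auto simp: continuous_in_sobolev_def)
  note d = sobolev_differentiable[OF \<open>s > 3/2\<close>]
  obtain c where c: "c \<ge> 0" "\<And>f x. f \<in> sobolev s \<Longrightarrow> \<bar>f x\<bar> \<le> c * sobolev_norm s f"
    using sobolev_embedding[of s] \<open>s > 3/2\<close> by auto
  obtain c1 where c1: "c1 \<ge> 0" "\<And>f x. f \<in> sobolev (s - 1) \<Longrightarrow> \<bar>f x\<bar> \<le> c1 * sobolev_norm (s - 1) f"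
    using sobolev_embedding[OF s1] by auto
  define p where "p = (\<lambda>t z. 1/2 * (deriv (u t) z)\<^sup>2)"
  have p: "p t \<in> sobolev (s - 1)" if "t \<ge> 0" for t
  proof -
    have "(\<lambda>z. (deriv (u t) z)\<^sup>2) \<in> sobolev (s - 1)"
      by (rule sobolev_square[OF s1 d(2)[OF us[OF that]]])
    from sobolev_linear[OF this this, of "1/2" 0] show ?thesis by (simp add: p_def)
  qed
  show False
  proof (rule classical_slope_blowup[where u = u and ut = ut and ux = "\<lambda>t. deriv (u t)"
        and F = "\<lambda>t x. - deriv (opA_inv (s - 1) (p t)) x" and Fx = "\<lambda>t x. - (mean (p t) - p t x)"])
    show "circle_fun (u t)" if "t \<ge> 0" for t
      by (rule sobolevD(1)[OF us[OF that]])
    show "continuous_on ({0..} \<times> UNIV) (\<lambda>z. u (fst z) (snd z))"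
    proof (rule continuous_on_Times_of_uniform[OF _ lim])
      show "\<bar>u \<tau> x - u t x\<bar> \<le> c * sobolev_norm s (\<lambda>x. u \<tau> x - u t x)"
        if "t \<in> {0..}" "\<tau> \<in> {0..}" for t \<tau> x
        by (rule c(2)) (use diff that in auto)
    qed (auto intro: circle_funD sobolevD(1)[OF us])
    show "continuous_on ({0..} \<times> UNIV) (\<lambda>z. deriv (u (fst z)) (snd z))"
    proof (rule continuous_on_Times_of_uniform[OF _ lim])
      show "\<bar>deriv (u \<tau>) x - deriv (u t) x\<bar> \<le> (c1 * (2 * pi)) * sobolev_norm s (\<lambda>x. u \<tau> x - u t x)"
        if "t \<in> {0..}" "\<tau> \<in> {0..}" for t \<tau> x
      proof -
        let ?w = "\<lambda>x. u \<tau> x - u t x"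
        have w: "?w \<in> sobolev s" using diff that by simp
        have "(?w has_real_derivative deriv (u \<tau>) x - deriv (u t) x) (at x)"
          by (intro DERIV_diff d(1) us) (use that in auto)
        then have "\<bar>deriv (u \<tau>) x - deriv (u t) x\<bar> = \<bar>deriv ?w x\<bar>"
          by (simp add: DERIV_imp_deriv)
        also have "\<dots> \<le> c1 * sobolev_norm (s - 1) (deriv ?w)"
          by (rule c1(2)[OF d(2)[OF w]])
        also have "\<dots> \<le> c1 * (2 * pi * sobolev_norm s ?w)"
          by (rule mult_left_mono[OF d(3)[OF w] c1(1)])
        finally show ?thesis by (simp add: mult.assoc)
      qed
    qed (auto intro: circle_funD sobolevD(1)[OF d(2)[OF us]])
    show "(u t has_real_derivative deriv (u t) x) (at x)" if "t \<ge> 0" for t x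
      by (rule d(1)[OF us[OF that]])
    show "((\<lambda>\<tau>. u \<tau> x) has_real_derivative ut t x) (at t within {0..})" if t: "t \<ge> 0" for t x
    proof -
      let ?r = "\<lambda>\<tau> x. (u \<tau> x - u t x) / (\<tau> - t) - ut t x"
      have r: "?r \<tau> \<in> sobolev (s - 1)" if "\<tau> \<ge> 0" for \<tau>
      proof -
        have "(\<lambda>x. 1 / (\<tau> - t) * u \<tau> x + - 1 / (\<tau> - t) * u t x) \<in> sobolev (s - 1)"
          by (intro sobolev_linear us1 that t)
        from sobolev_linear[OF this us1(2)[OF t], of 1 "-1"]
        show ?thesis by (simp add: diff_divide_distrib)
      qed
      have "((\<lambda>\<tau>. c1 * sobolev_norm (s - 1) (?r \<tau>)) \<longlongrightarrow> 0) (at t within {0..})"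
        using C1 t by (intro tendsto_mult_right_zero) (auto simp: C1_in_sobolev_def)
      then have "((\<lambda>\<tau>. ?r \<tau> x) \<longlongrightarrow> 0) (at t within {0..})"
      proof (rule Lim_null_comparison[rotated])
        show "\<forall>\<^sub>F \<tau> in at t within {0..}. norm (?r \<tau> x) \<le> c1 * sobolev_norm (s - 1) (?r \<tau>)"
          unfolding eventually_at_filter real_norm_def
          by (intro always_eventually allI impI c1(2) r) simp
      qed
      then show ?thesis
        unfolding has_field_derivative_iff by (simp add: LIM_zero_iff)
    qed
    show "ut t x = - (u t x * deriv (u t) x) + - deriv (opA_inv (s - 1) (p t)) x - lam * u t x"
      if "t \<ge> 0" for t x
      using eq[OF that, of x] by (simp add: mean0 p_def)
    show "((\<lambda>x. - deriv (opA_inv (s - 1) (p t)) x) has_real_derivative - (mean (p t) - p t x)) (at x)"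
      if "t \<ge> 0" for t x
      by (intro DERIV_minus opA_inv_second_derivative s1 p that)
    show "- (mean (p t) - p t x) \<le> 1/2 * (deriv (u t) x)\<^sup>2" if "t \<ge> 0" for t x
      using mean_nonneg[OF sobolevD(1)[OF p[OF that]]] by (simp add: p_def)
  qed (use assms init in auto)
qed

end
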